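(* Let $\Sigma\in\mathcal H_\alpha$ for some $\alpha>0$, where $\Sigma$ is the covariance matrix of the data distribution described in the context. Consider the blockwise tridiagonal estimator $\hat\Sigma^{\mathsf{DP}}=\mathsf{DPCovTri}(X;k,\rho,R)$ described in the context, with block size $k\le cn$ for some small constant $c>0$. Then $$ \frac1d\,\mathbb E\|\hat\Sigma^{\mathsf{DP}}-\Sigma\|_F^2\;\lesssim\;\frac kn+\frac{dk^2}{\rho n^2}+k^{-(2\alpha+1)}. $$
   Context: Norms: $\|\cdot\|_F$ is the Frobenius norm. $\|X\|_{\psi_2}=\sup_{\|v\|_2=1}\inf\{t>0:\mathbb E e^{\langle X,v\rangle^2/t^2}\le2\}$. Model and class. $X_1,\dots,X_n$ are i.i.d. in $\mathbb R^d$ with mean $0$, covariance $\Sigma$ and $\|X_1\|_{\psi_2}\le K$; $K,M_0,M$ are fixed. $\mathcal H_\alpha=\mathcal H_\alpha(M_0,M)$ is the set of covariance matrices with $0\preceq\Sigma\preceq M_0I_d$ and $|\Sigma_{ij}|\le M|i-j|^{-(\alpha+1)}$ for $i\ne j$. Estimator. For a square block $B=I\times J$, budget $\rho_B$ and clipping radius $R$, $\mathsf{DPCovBlock}(X,B;\rho_B,R)$ returns (supported on $B$) $$\frac1n\sum_{i=1}^n\chi_R(X_{i,I})\chi_R(X_{i,J})^\top+\sigma_BM_B,\qquad\sigma_B^2=\frac{18R^4}{\rho_Bn^2},$$ where $\chi_R(z)=z\min\{1,R/\|z\|_2\}$, $\chi_R(0)=0$, and $M_B$ is the $B$-block of a fresh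 random symmetric $d\times d$ matrix whose upper triangular entries (including the diagonal) are i.i.d. $N(0,1)$. Given a block size $k\ge1$, the data are padded with deterministic zero coordinates so that $d=2^Jk$ for an integer $J\ge0$ (the estimate of the original $\Sigma$ being the corresponding principal submatrix). Put $N_k=d/k$, $I_{k,\ell}=\{1+(\ell-1)k,\dots,\ell k\}$, $B_{k;\ell,r}=I_{k,\ell}\times I_{k,\ell+r}$. $\mathsf{DPCovTri}(X;k,\rho,R)$ sets $\rho_0=\rho/(2N_k)$, fills each block $B_{k;\ell,r}$ with $r\in\{0,1\}$, $\ell\ge1$, $\ell+r\le N_k$ by $\mathsf{DPCovBlock}(X,B_{k;\ell,r};\rho_0,R)$, fills the lower triangular part by symmetry and sets all other entries to zero. Here $R=CK\sqrt k$ with $C$ a sufficiently large numerical constant. Regime and constants. Statements are along sequences $(n,d,\rho)$, $n\to\infty$, with $d\gtrsim\log n$, $0<\rho\lesssim1$ (fixed upper bound), $d/(\rho n^2)\to0$. $a\lesssim b$ means $a\le C'b$ for all sufficiently large $n$ with $C'$ not depending on $n,d,\rho,k$ or on the particular distribution (it may depend on $\alpha,K,M_0,M$ and the regime constants). *)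

theory Defs
  imports "HOL-Probability.Probability"
begin

text \<open>
  The dimension varies inside the theorem, so vectors in \<open>\<real>\<^sup>d\<close> are functions \<open>nat \<Rightarrow> real\<close> read
  on the coordinates \<open>{1..d}\<close>, and \<open>d \<times> d\<close> matrices are functions \<open>nat \<Rightarrow> nat \<Rightarrow> real\<close> read on
  \<open>{1..d} \<times> {1..d}\<close>; values outside these index sets carry no meaning.
\<close>

type_synonym rvec = "nat \<Rightarrow> real"
type_synonym rmat = "nat \<Rightarrow> nat \<Rightarrow> real"

definition inner_upto :: "nat \<Rightarrow> rvec \<Rightarrow> rvec \<Rightarrow> real" where
  "inner_upto d x v = (\<Sum>i\<in>{1..d}. x i * v i)"

definition quad_form :: "nat \<Rightarrow> rmat \<Rightarrow> rvec \<Rightarrow> real" where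
  "quad_form d A v = (\<Sum>i\<in>{1..d}. \<Sum>j\<in>{1..d}. v i * A i j * v j)"

definition frob_norm :: "nat \<Rightarrow> rmat \<Rightarrow> real" where
  "frob_norm d A = L2_set (\<lambda>(i, j). A i j) ({1..d} \<times> {1..d})"


subsection \<open>Data distribution and covariance class\<close>

definition vec_space :: "nat \<Rightarrow> rvec measure" where
  "vec_space d = (\<Pi>\<^sub>M i\<in>{1..d}. borel)"

text \<open>
  The norm takes values in \<^typ>\<open>ennreal\<close>, where the infimum of the empty set and the supremum of
  an unbounded set are \<open>\<infinity>\<close>, as intended.
\<close>

definition psi2_norm :: "nat \<Rightarrow> rvec measure \<Rightarrow> ennreal" where
  "psi2_norm d P =
     (SUP v\<in>{v. L2_set v {1..d} = 1}.
        INF t\<in>{t::real. t > 0 \<and> (\<integral>\<^sup>+ x. ennreal (exp ((inner_upto d x v)\<^sup>2 / t\<^sup>2)) \<partial>P) \<le> 2}.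
          ennreal t)"

definition is_covariance :: "nat \<Rightarrow> rvec measure \<Rightarrow> rmat \<Rightarrow> bool" where
  "is_covariance d P S \<longleftrightarrow>
     (\<forall>i\<in>{1..d}. \<forall>j\<in>{1..d}.
        integrable P (\<lambda>x. (x i - (\<integral>y. y i \<partial>P)) * (x j - (\<integral>y. y j \<partial>P))) \<and>
        S i j = (\<integral>x. (x i - (\<integral>y. y i \<partial>P)) * (x j - (\<integral>y. y j \<partial>P)) \<partial>P))"

definition data_law :: "nat \<Rightarrow> real \<Rightarrow> rmat \<Rightarrow> rvec measure \<Rightarrow> bool" where
  "data_law d K S P \<longleftrightarrow>
     prob_space P \<and> sets P = sets (vec_space d) \<and>
     (\<forall>i\<in>{1..d}. integrable P (\<lambda>x. x i) \<and> (\<integral>x. x i \<partial>P) = 0) \<and>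
     is_covariance d P S \<and>
     psi2_norm d P \<le> ennreal K"

definition cov_class :: "nat \<Rightarrow> real \<Rightarrow> real \<Rightarrow> real \<Rightarrow> rmat set" where
  "cov_class d \<alpha> M0 M =
     {S. (\<forall>i\<in>{1..d}. \<forall>j\<in>{1..d}. S i j = S j i) \<and>
         (\<forall>v. 0 \<le> quad_form d S v \<and> quad_form d S v \<le> M0 * inner_upto d v v) \<and>
         (\<forall>i\<in>{1..d}. \<forall>j\<in>{1..d}. i \<noteq> j \<longrightarrow>
            \<bar>S i j\<bar> \<le> M * \<bar>real i - real j\<bar> powr (- (\<alpha> + 1)))}"


subsection \<open>The estimator\<close>

definition clip_block :: "real \<Rightarrow> nat set \<Rightarrow> rvec \<Rightarrow> rvec" where
  "clip_block R I x =
     (\<lambda>i. if L2_set x I = 0 then 0 else x i * min 1 (R / L2_set x I))"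

text \<open>
  \<open>X s\<close> is the \<open>s\<close>-th sample, \<open>s \<in> {1..n}\<close>; \<open>Z\<close> is the symmetric standard Gaussian matrix of
  the block.
\<close>

definition dp_cov_block ::
  "nat \<Rightarrow> (nat \<Rightarrow> rvec) \<Rightarrow> nat set \<Rightarrow> nat set \<Rightarrow> real \<Rightarrow> real \<Rightarrow> rmat \<Rightarrow> rmat" where
  "dp_cov_block n X I J \<rho>B R Z =
     (\<lambda>i j. if i \<in> I \<and> j \<in> J
        then (\<Sum>s\<in>{1..n}. clip_block R I (X s) i * clip_block R J (X s) j) / real n
             + sqrt (18 * R ^ 4 / (\<rho>B * (real n)\<^sup>2)) * Z i j
        else 0)"

definition block_interval :: "nat \<Rightarrow> nat \<Rightarrow> nat set" where
  "block_interval k l = {1 + (l - 1) * k .. l * k}"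

definition tri_blocks :: "nat \<Rightarrow> (nat \<times> nat) set" where
  "tri_blocks N = {(l, r). 1 \<le> l \<and> r \<in> {0, 1} \<and> l + r \<le> N}"

text \<open>
  A noise outcome assigns to \<open>(l, r, i, j)\<close>, \<open>i \<le> j\<close>, the \<open>(i, j)\<close> entry of the matrix drawn for
  the block \<open>(l, r)\<close>; \<open>sym_noise\<close> reflects it to a symmetric matrix.
\<close>

type_synonym noise = "nat \<times> nat \<times> nat \<times> nat \<Rightarrow> real"

definition sym_noise :: "noise \<Rightarrow> nat \<Rightarrow> nat \<Rightarrow> rmat" where
  "sym_noise w l r = (\<lambda>i j. w (l, r, min i j, max i j))"

definition noise_space :: "nat \<Rightarrow> nat \<Rightarrow> noise measure" where
  "noise_space d k =
     (\<Pi>\<^sub>M q\<in>{(l, r, i, j). (l, r) \<in> tri_blocks (d div k) \<and> 1 \<le> i \<and> i \<le> j \<and> j \<le> d}.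
        density lborel (\<lambda>x. ennreal (std_normal_density x)))"

text \<open>
  Here \<open>d\<close> is a multiple of \<open>k\<close>. The blocks have pairwise disjoint supports, so filling
  them in amounts to summing; the lower triangle is the reflection of the upper one.
\<close>

definition dp_cov_tri ::
  "nat \<Rightarrow> nat \<Rightarrow> nat \<Rightarrow> real \<Rightarrow> real \<Rightarrow> (nat \<Rightarrow> rvec) \<Rightarrow> noise \<Rightarrow> rmat" where
  "dp_cov_tri n d k \<rho> R X w =
     (let N = d div k;
          \<rho>0 = \<rho> / (2 * real N);
          U = (\<lambda>i j. \<Sum>(l, r)\<in>tri_blocks N.
                 dp_cov_block n X (block_interval k l) (block_interval k (l + r)) \<rho>0 R
                   (sym_noise w l r) i j)
      in (\<lambda>i j. if i \<le> j then U i j else U j i))"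

text \<open>Padding by zero coordinates up to the least \<open>2 ^ J * k \<ge> d\<close>.\<close>

definition padded_dim :: "nat \<Rightarrow> nat \<Rightarrow> nat" where
  "padded_dim d k = 2 ^ (LEAST J. d \<le> 2 ^ J * k) * k"

definition pad_vec :: "nat \<Rightarrow> rvec \<Rightarrow> rvec" where
  "pad_vec d x = (\<lambda>i. if i \<in> {1..d} then x i else 0)"

text \<open>
  Joint law of \<open>n\<close> i.i.d. samples from \<open>P\<close> and the independent noise.
\<close>

definition sample_space :: "nat \<Rightarrow> nat \<Rightarrow> nat \<Rightarrow> rvec measure \<Rightarrow> ((nat \<Rightarrow> rvec) \<times> noise) measure" where
  "sample_space n d k P = (\<Pi>\<^sub>M s\<in>{1..n}. P) \<Otimes>\<^sub>M noise_space (padded_dim d k) k"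

text \<open>
  \<open>tri_risk n d k \<rho> R P S\<close> is the expected squared Frobenius error on the original \<open>d \<times> d\<close>
  principal submatrix.
\<close>

definition tri_risk ::
  "nat \<Rightarrow> nat \<Rightarrow> nat \<Rightarrow> real \<Rightarrow> real \<Rightarrow> rvec measure \<Rightarrow> rmat \<Rightarrow> ennreal" where
  "tri_risk n d k \<rho> R P S =
     (\<integral>\<^sup>+ (X, w).
        ennreal ((frob_norm d (\<lambda>i j.
          dp_cov_tri n (padded_dim d k) k \<rho> R (\<lambda>s. pad_vec d (X s)) w i j - S i j))\<^sup>2)
      \<partial>sample_space n d k P)"


subsection \<open>Asymptotic regime\<close>

text \<open>
  \<open>a\<close> and \<open>b\<close> are the constants of \<open>log n \<lesssim> d\<close> and \<open>\<rho> \<lesssim> 1\<close>.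
\<close>

definition regime :: "real \<Rightarrow> real \<Rightarrow> (nat \<Rightarrow> nat) \<Rightarrow> (nat \<Rightarrow> nat) \<Rightarrow> (nat \<Rightarrow> real) \<Rightarrow> bool" where
  "regime a b n d \<rho> \<longleftrightarrow>
     filterlim n at_top sequentially \<and>
     (\<forall>\<^sub>F m in sequentially. ln (real (n m)) \<le> a * real (d m)) \<and>
     (\<forall>\<^sub>F m in sequentially. 0 < \<rho> m \<and> \<rho> m \<le> b) \<and>
     (\<lambda>m. real (d m) / (\<rho> m * (real (n m))\<^sup>2)) \<longlonglongrightarrow> 0"

end

theory Submission
  imports Defs
begin

text \<open>
  Since the squared Frobenius norm is the sum of the squared entries, the risk can be bounded entry
  by entry. An entry outside the tridiagonal blocks is estimated by \<open>0\<close> and sits at distance more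
  than \<open>k\<close> from the diagonal, so summing the squared decay condition along a row contributes
  \<open>k powr (- (2 * \<alpha> + 1))\<close> (\<open>sum_far_le\<close>). A row has at most \<open>min d (4 * k)\<close> entries inside the
  blocks, and the error of such an entry splits into three parts (\<open>tri_error_upper\<close>).

  Sampling: the empirical mean of \<open>n\<close> independent clipped products has variance at most their
  second moment over \<open>n\<close>. Clipping only shrinks entries, and subgaussian entries have bounded fourth
  moments, which gives \<open>k / n\<close> per row.

  Privacy: the Gaussian noise has variance of order \<open>R ^ 4 * N / (\<rho> * n\<^sup>2)\<close> with \<open>R\<^sup>2\<close> of order \<open>k\<close> and
  \<open>N\<close> blocks. The number of noisy entries per row times \<open>N\<close> is of order \<open>d\<close>
  (\<open>near_count_times_blocks_le\<close>), which gives \<open>d * k\<^sup>2 / (\<rho> * n\<^sup>2)\<close>.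

  Clipping bias: it is controlled by the probability that a block of \<open>k\<close> coordinates has norm above
  \<open>R\<close>. The coordinates need not be independent, but a Gaussian average of the one-dimensional
  exponential moments (\<open>exp_sum_squares_le\<close>) shows that this probability is at most
  \<open>2 * exp (- k)\<close> once \<open>R\<close> is a large enough multiple of \<open>K * sqrt k\<close>.
  Hence the squared bias adds a multiple of \<open>k * exp (- k)\<close> per row, which is below
  every power of \<open>k\<close> up to a constant and so is absorbed by \<open>k powr (- (2 * \<alpha> + 1))\<close>.
\<close>

section \<open>Gaussian integrals\<close>

abbreviation std_normal :: "real measure" where
  "std_normal \<equiv> density lborel (\<lambda>x. ennreal (std_normal_density x))"

lemma nn_integral_normal_density:
  assumes "0 < \<sigma>"
  shows "(\<integral>\<^sup>+x. ennreal (normal_density \<mu> \<sigma> x) \<partial>lborel) = 1"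
  using assms by (subst nn_integral_eq_integral) auto

text \<open>
  These two integrals drive the bound on block norms: the first, read from right to left, writes
  the exponential of a square as a Gaussian average of exponentials of linear functions; the second
  bounds what such an average costs per coordinate.
\<close>

lemma nn_integral_std_normal_exp_linear:
  "(\<integral>\<^sup>+g. ennreal (exp (a * g)) \<partial>std_normal) = ennreal (exp (a\<^sup>2 / 2))"
proof -
  have eq: "std_normal_density g * exp (a * g) = exp (a\<^sup>2 / 2) * normal_density a 1 g" for g
    by (simp add: normal_density_def mult_exp_exp power2_eq_square field_simps flip: exp_add)
  have "(\<integral>\<^sup>+g. ennreal (exp (a * g)) \<partial>std_normal)
      = (\<integral>\<^sup>+g. ennreal (exp (a\<^sup>2 / 2)) * ennreal (normal_density a 1 g) \<partial>lborel)"
    by (subst nn_integral_density) (auto simp: eq simp flip: ennreal_mult intro!: nn_integral_cong)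
  also have "\<dots> = ennreal (exp (a\<^sup>2 / 2))"
    by (subst nn_integral_cmult) (auto simp: nn_integral_normal_density)
  finally show ?thesis .
qed

lemma nn_integral_std_normal_exp_square:
  "(\<integral>\<^sup>+g. ennreal (exp (g\<^sup>2 / 4)) \<partial>std_normal) = ennreal (sqrt 2)"
proof -
  have eq: "std_normal_density g * exp (g\<^sup>2 / 4) = sqrt 2 * normal_density 0 (sqrt 2) g" for g
    by (simp add: normal_density_def real_sqrt_mult field_simps flip: exp_add)
  have "(\<integral>\<^sup>+g. ennreal (exp (g\<^sup>2 / 4)) \<partial>std_normal)
      = (\<integral>\<^sup>+g. ennreal (sqrt 2) * ennreal (normal_density 0 (sqrt 2) g) \<partial>lborel)"
    by (subst nn_integral_density) (auto simp: eq simp flip: ennreal_mult intro!: nn_integral_cong)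
  also have "\<dots> = ennreal (sqrt 2)"
    by (subst nn_integral_cmult) (auto simp: nn_integral_normal_density)
  finally show ?thesis .
qed

lemma nn_integral_std_normal_square:
  "(\<integral>\<^sup>+g. ennreal (g\<^sup>2) \<partial>std_normal) = 1"
proof -
  have "has_bochner_integral lborel (\<lambda>x. std_normal_density x * x\<^sup>2) 1"
    using std_normal_moment_even[of 1] by simp
  then have "(\<integral>\<^sup>+x. ennreal (std_normal_density x * x\<^sup>2) \<partial>lborel) = ennreal 1"
    by (intro nn_integral_eq_integral[THEN trans])
       (auto dest: has_bochner_integral_integral_eq simp: has_bochner_integral_iff)
  then show ?thesis
    by (subst nn_integral_density) (auto simp: ennreal_mult)
qed

lemma prob_space_std_normal: "prob_space std_normal"
  by (rule prob_space_normal_density) simp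

section \<open>Vectors whose one-dimensional marginals are subgaussian\<close>

text \<open>
  The parameter \<open>t\<close> stands for any number above the \<open>\<psi>\<^sub>2\<close> norm, so that the infimum in that norm
  never has to be attained.
\<close>

locale subgaussian_law = prob_space P for P :: "rvec measure" +
  fixes d :: nat and t :: real
  assumes sets_P: "sets P = sets (vec_space d)"
    and t_pos: "0 < t"
    and subgaussian: "L2_set v {1..d} = 1 \<Longrightarrow>
      (\<integral>\<^sup>+x. ennreal (exp ((inner_upto d x v)\<^sup>2 / t\<^sup>2)) \<partial>P) \<le> 2"
begin

lemma measurable_coord [measurable (raw)]:
  "i \<in> {1..d} \<Longrightarrow> (\<lambda>x. x i) \<in> borel_measurable P"
  unfolding measurable_cong_sets[OF sets_P refl] vec_space_def by measurable

lemma measurable_inner_upto [measurable]: "(\<lambda>x. inner_upto d x v) \<in> borel_measurable P"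
  unfolding inner_upto_def by measurable

text \<open>
  By the inequality \<open>l * y \<le> y\<^sup>2 / t\<^sup>2 + t\<^sup>2 * l\<^sup>2 / 4\<close>, with \<open>l\<close> the length of \<open>v\<close> and \<open>y\<close> the
  component of the random vector along \<open>v / l\<close>, the squared exponent of the hypothesis dominates a
  linear one.
\<close>

lemma exp_inner_le:
  "(\<integral>\<^sup>+x. ennreal (exp (inner_upto d x v)) \<partial>P)
    \<le> ennreal (2 * exp (t\<^sup>2 * (\<Sum>i\<in>{1..d}. (v i)\<^sup>2) / 4))"
proof (cases "L2_set v {1..d} = 0")
  case True
  then have "\<forall>i\<in>{1..d}. v i = 0"
    by (subst (asm) L2_set_eq_0_iff) auto
  then have "inner_upto d x v = 0" for x
    by (simp add: inner_upto_def)
  with \<open>\<forall>i\<in>{1..d}. v i = 0\<close> show ?thesis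
    by (simp add: emeasure_space_1)
next
  case False
  define l where "l = L2_set v {1..d}"
  have l: "l > 0" "l\<^sup>2 = (\<Sum>i\<in>{1..d}. (v i)\<^sup>2)"
    using False L2_set_nonneg[of v "{1..d}"] by (auto simp: l_def less_le L2_set_def sum_nonneg)
  define u where "u i = v i / l" for i
  have "L2_set u {1..d} = 1"
    using l(1) by (simp add: u_def L2_set_def power_divide real_sqrt_divide flip: sum_divide_distrib)
      (simp add: l_def L2_set_def)
  note sub = subgaussian[OF this]
  have inner: "inner_upto d x v = l * inner_upto d x u" for x
    using l by (simp add: inner_upto_def u_def sum_distrib_left)
  have amgm: "l * y \<le> y\<^sup>2 / t\<^sup>2 + t\<^sup>2 * l\<^sup>2 / 4" for y
  proof -
    have "0 \<le> (y / t - t * l / 2)\<^sup>2" by simp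
    also have "\<dots> = y\<^sup>2 / t\<^sup>2 + t\<^sup>2 * l\<^sup>2 / 4 - l * y"
      using t_pos by (simp add: power2_diff power_divide power_mult_distrib)
    finally show ?thesis by simp
  qed
  have "(\<integral>\<^sup>+x. ennreal (exp (inner_upto d x v)) \<partial>P)
     \<le> (\<integral>\<^sup>+x. ennreal (exp (t\<^sup>2 * l\<^sup>2 / 4)) * ennreal (exp ((inner_upto d x u)\<^sup>2 / t\<^sup>2)) \<partial>P)"
    unfolding inner using amgm
    by (intro nn_integral_mono) (simp add: add.commute flip: ennreal_mult exp_add)
  also have "\<dots> = ennreal (exp (t\<^sup>2 * l\<^sup>2 / 4)) * (\<integral>\<^sup>+x. ennreal (exp ((inner_upto d x u)\<^sup>2 / t\<^sup>2)) \<partial>P)"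
    by (intro nn_integral_cmult) simp
  also have "\<dots> \<le> ennreal (exp (t\<^sup>2 * l\<^sup>2 / 4)) * 2"
    by (intro mult_left_mono sub) simp
  finally show ?thesis
    by (simp add: l ennreal_mult mult.commute)
qed

text \<open>
  A direction-by-direction bound does not control the norm pointwise. Averaging over a random
  direction does: for a standard Gaussian vector \<open>g\<close> on the coordinates \<open>J\<close>, the average of
  \<open>exp (\<langle>x, g\<rangle> / t)\<close> over \<open>g\<close> is \<open>exp (|x|\<^sup>2 / (2 * t\<^sup>2))\<close>. Exchanging the two integrals, the
  one over \<open>x\<close> is bounded by \<open>2 * exp (|g|\<^sup>2 / 4)\<close>, whose Gaussian average is a product of one-dimensional
  integrals. This takes the place of a union bound over a net of the sphere.
\<close>

lemma exp_sum_squares_le: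
  assumes J: "J \<subseteq> {1..d}"
  shows "(\<integral>\<^sup>+x. ennreal (exp ((\<Sum>j\<in>J. (x j)\<^sup>2) / (2 * t\<^sup>2))) \<partial>P) \<le> ennreal (2 * sqrt 2 ^ card J)"
proof -
  have fin: "finite J" using J finite_subset by blast
  let ?G = "\<Pi>\<^sub>M j\<in>J. std_normal"
  interpret N: prob_space std_normal by (rule prob_space_std_normal)
  interpret G: product_prob_space "\<lambda>_. std_normal" J ..
  interpret G': prob_space ?G by (intro prob_space_PiM prob_space_std_normal)
  interpret PG: pair_sigma_finite P ?G ..
  define v where "v g = (\<lambda>i. if i \<in> J then g i / t else 0)" for g :: rvec
  have inner: "inner_upto d x (v g) = (\<Sum>j\<in>J. x j / t * g j)" for x g
    using J unfolding inner_upto_def v_def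
    by (subst sum.mono_neutral_right[of "{1..d}" J]) (auto intro!: sum.cong)
  have norm: "t\<^sup>2 * (\<Sum>i\<in>{1..d}. (v g i)\<^sup>2) / 4 = (\<Sum>j\<in>J. (g j)\<^sup>2 / 4)" for g
  proof -
    have "(\<Sum>i\<in>{1..d}. (v g i)\<^sup>2) = (\<Sum>j\<in>J. (g j)\<^sup>2 / t\<^sup>2)"
      using J unfolding v_def
      by (subst sum.mono_neutral_right[of "{1..d}" J]) (auto intro!: sum.cong simp: power_divide)
    then show ?thesis
      using t_pos by (simp add: sum_divide_distrib sum_distrib_left)
  qed
  have "(\<integral>\<^sup>+x. ennreal (exp ((\<Sum>j\<in>J. (x j)\<^sup>2) / (2 * t\<^sup>2))) \<partial>P)
      = (\<integral>\<^sup>+x. (\<integral>\<^sup>+g. ennreal (exp (\<Sum>j\<in>J. x j / t * g j)) \<partial>?G) \<partial>P)"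
  proof (intro nn_integral_cong)
    fix x
    have "(\<integral>\<^sup>+g. ennreal (exp (\<Sum>j\<in>J. x j / t * g j)) \<partial>?G)
        = (\<integral>\<^sup>+g. (\<Prod>j\<in>J. ennreal (exp (x j / t * g j))) \<partial>?G)"
      using fin by (simp add: exp_sum prod_ennreal)
    also have "\<dots> = (\<Prod>j\<in>J. ennreal (exp ((x j / t)\<^sup>2 / 2)))"
      using fin by (subst G.product_nn_integral_prod) (auto simp only: nn_integral_std_normal_exp_linear, auto)
    also have "\<dots> = ennreal (exp ((\<Sum>j\<in>J. (x j)\<^sup>2) / (2 * t\<^sup>2)))"
      using fin by (simp add: prod_ennreal power_divide sum_divide_distrib mult.commute flip: exp_sum)
    finally show "ennreal (exp ((\<Sum>j\<in>J. (x j)\<^sup>2) / (2 * t\<^sup>2)))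
      = (\<integral>\<^sup>+g. ennreal (exp (\<Sum>j\<in>J. x j / t * g j)) \<partial>?G)" by simp
  qed
  also have "\<dots> = (\<integral>\<^sup>+g. (\<integral>\<^sup>+x. ennreal (exp (\<Sum>j\<in>J. x j / t * g j)) \<partial>P) \<partial>?G)"
  proof (rule PG.Fubini'[symmetric])
    have [measurable]: "(\<lambda>p. fst p j) \<in> borel_measurable (P \<Otimes>\<^sub>M ?G)" if "j \<in> J" for j
      using that J by (intro measurable_compose[OF measurable_fst measurable_coord]) auto
    have [measurable]: "(\<lambda>p. snd p j) \<in> borel_measurable (P \<Otimes>\<^sub>M ?G)" if "j \<in> J" for j
      using that by (intro measurable_compose[OF measurable_snd]) auto
    show "(\<lambda>(x, g). ennreal (exp (\<Sum>j\<in>J. x j / t * g j))) \<in> borel_measurable (P \<Otimes>\<^sub>M ?G)"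
      unfolding case_prod_beta by measurable
  qed
  also have "\<dots> \<le> (\<integral>\<^sup>+g. ennreal (2 * exp (\<Sum>j\<in>J. (g j)\<^sup>2 / 4)) \<partial>?G)"
    using exp_inner_le[of "v _"] unfolding inner norm by (intro nn_integral_mono) 
  also have "\<dots> = 2 * (\<integral>\<^sup>+g. (\<Prod>j\<in>J. ennreal (exp ((g j)\<^sup>2 / 4))) \<partial>?G)"
    using fin by (subst nn_integral_cmult[symmetric])
      (auto simp: exp_sum prod_ennreal ennreal_mult prod_nonneg)
  also have "\<dots> = 2 * ennreal (sqrt 2) ^ card J"
    using fin by (subst G.product_nn_integral_prod) (auto simp only: nn_integral_std_normal_exp_square, auto)
  finally show ?thesis
    by (simp add: ennreal_mult ennreal_power)
qed

text \<open>
  This is \<open>y\<^sup>2 \<le> 2 * exp y\<close> at \<open>y = (x i)\<^sup>2 / t\<^sup>2\<close>, integrated.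
\<close>

lemma fourth_moment_le:
  assumes "i \<in> {1..d}"
  shows "(\<integral>\<^sup>+x. ennreal ((x i) ^ 4) \<partial>P) \<le> ennreal (4 * t ^ 4)"
proof -
  let ?e = "\<lambda>j. if j = i then 1 else 0 :: real"
  have "L2_set ?e {1..d} = 1"
    using assms by (simp add: L2_set_def if_distrib[of "\<lambda>x. x\<^sup>2"] cong: if_cong)
  note sub = subgaussian[OF this]
  have inner: "inner_upto d x ?e = x i" for x
    using assms by (simp add: inner_upto_def if_distrib[of "\<lambda>y. _ * y"] cong: if_cong)
  have pow: "(x i) ^ 4 \<le> 2 * t ^ 4 * exp ((x i)\<^sup>2 / t\<^sup>2)" for x :: rvec
  proof -
    have "((x i)\<^sup>2 / t\<^sup>2)\<^sup>2 / 2 \<le> exp ((x i)\<^sup>2 / t\<^sup>2)"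
      using exp_lower_Taylor_quadratic[of "(x i)\<^sup>2 / t\<^sup>2"] by (smt (verit) divide_nonneg_nonneg zero_le_power2)
    then show ?thesis
      using t_pos by (simp add: power_divide field_simps flip: power_mult)
  qed
  have "(\<integral>\<^sup>+x. ennreal ((x i) ^ 4) \<partial>P)
      \<le> (\<integral>\<^sup>+x. ennreal (2 * t ^ 4) * ennreal (exp ((x i)\<^sup>2 / t\<^sup>2)) \<partial>P)"
    using pow by (intro nn_integral_mono) (simp flip: ennreal_mult)
  also have "\<dots> = ennreal (2 * t ^ 4) * (\<integral>\<^sup>+x. ennreal (exp ((x i)\<^sup>2 / t\<^sup>2)) \<partial>P)"
    using assms by (intro nn_integral_cmult) simp
  also have "\<dots> \<le> ennreal (2 * t ^ 4) * 2"
    using sub by (intro mult_left_mono) (auto simp: inner)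
  also have "\<dots> = ennreal (2 * t ^ 4 * 2)"
    using t_pos by (subst ennreal_mult) auto
  finally show ?thesis by (simp add: mult.commute)
qed

text \<open>
  Markov's inequality for the exponential of the squared norm. The threshold is chosen such that it
  gains a factor \<open>exp (- 2 * k)\<close>, half of which absorbs the dimension factor \<open>sqrt 2 ^ k\<close>.
\<close>

lemma emeasure_norm_gt_le:
  assumes J: "J \<subseteq> {1..d}" and card: "card J \<le> k" and R: "0 \<le> R" "4 * t\<^sup>2 * real k \<le> R\<^sup>2"
  shows "emeasure P {x \<in> space P. R < L2_set x J} \<le> ennreal (2 * exp (- real k))"
proof -
  let ?e = "\<lambda>x. exp ((\<Sum>j\<in>J. (x j)\<^sup>2) / (2 * t\<^sup>2))"
  let ?A = "{x \<in> space P. R < L2_set x J}"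
  have [measurable]: "(\<lambda>x. x j) \<in> borel_measurable P" if "j \<in> J" for j
    using that J by auto
  have ind: "indicator ?A x \<le> ennreal (exp (- 2 * real k)) * ennreal (?e x)" for x
  proof (cases "x \<in> ?A")
    case True
    then have "R\<^sup>2 \<le> (L2_set x J)\<^sup>2"
      using R by (intro power_mono) auto
    also have "\<dots> = (\<Sum>j\<in>J. (x j)\<^sup>2)"
      by (simp add: L2_set_def sum_nonneg)
    finally have "4 * t\<^sup>2 * real k \<le> (\<Sum>j\<in>J. (x j)\<^sup>2)"
      using R by simp
    then have "2 * real k \<le> (\<Sum>j\<in>J. (x j)\<^sup>2) / (2 * t\<^sup>2)"
      using t_pos by (simp add: field_simps)
    then show ?thesis
      using True by (simp flip: ennreal_mult exp_add)
  qed simp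
  have "emeasure P ?A = (\<integral>\<^sup>+x. indicator ?A x \<partial>P)"
    by (subst nn_integral_indicator) (auto simp: L2_set_def)
  also have "\<dots> \<le> (\<integral>\<^sup>+x. ennreal (exp (- 2 * real k)) * ennreal (?e x) \<partial>P)"
    by (intro nn_integral_mono ind)
  also have "\<dots> = ennreal (exp (- 2 * real k)) * (\<integral>\<^sup>+x. ennreal (?e x) \<partial>P)"
    by (intro nn_integral_cmult) simp
  also have "\<dots> \<le> ennreal (exp (- 2 * real k)) * ennreal (2 * sqrt 2 ^ card J)"
    by (intro mult_left_mono exp_sum_squares_le J) simp
  also have "\<dots> \<le> ennreal (2 * exp (- real k))"
  proof -
    have "sqrt 2 \<le> exp 1"
      using exp_ge_add_one_self[of 1] real_le_lsqrt[of 2 2] by simp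
    then have "sqrt 2 ^ card J \<le> exp 1 ^ k"
      using power_increasing[OF card, of "sqrt 2"] power_mono[of "sqrt 2" "exp 1" k] by (smt (verit) real_sqrt_ge_one real_sqrt_ge_zero)
    then have "exp (- 2 * real k) * (2 * sqrt 2 ^ card J) \<le> exp (- 2 * real k) * (2 * exp (real k))"
      by (simp flip: exp_of_nat_mult)
    also have "\<dots> = 2 * exp (- real k)"
      by (simp flip: exp_add)
    finally show ?thesis
      by (simp flip: ennreal_mult)
  qed
  finally show ?thesis .
qed

lemma product_second_moment_le:
  assumes "i \<in> {1..d}" "j \<in> {1..d}"
  shows "(\<integral>\<^sup>+x. ennreal ((x i * x j)\<^sup>2) \<partial>P) \<le> ennreal (4 * t ^ 4)"
proof -
  note [measurable] = measurable_coord[OF assms(1)] measurable_coord[OF assms(2)]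
  have le: "(x i * x j)\<^sup>2 \<le> (x i) ^ 4 / 2 + (x j) ^ 4 / 2" for x :: rvec
    using sum_squares_bound[of "(x i)\<^sup>2" "(x j)\<^sup>2"] by (simp add: power_mult_distrib)
  have "(\<integral>\<^sup>+x. ennreal ((x i * x j)\<^sup>2) \<partial>P)
      \<le> (\<integral>\<^sup>+x. ennreal (1 / 2) * ennreal ((x i) ^ 4) + ennreal (1 / 2) * ennreal ((x j) ^ 4) \<partial>P)"
    using le by (intro nn_integral_mono) (simp del: ennreal_half flip: ennreal_mult ennreal_plus)
  also have "\<dots> = ennreal (1 / 2) * (\<integral>\<^sup>+x. ennreal ((x i) ^ 4) \<partial>P)
      + ennreal (1 / 2) * (\<integral>\<^sup>+x. ennreal ((x j) ^ 4) \<partial>P)"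
    by (simp add: nn_integral_add nn_integral_cmult)
  also have "\<dots> \<le> ennreal (1 / 2) * ennreal (4 * t ^ 4) + ennreal (1 / 2) * ennreal (4 * t ^ 4)"
    by (intro add_mono mult_left_mono fourth_moment_le assms) auto
  also have "\<dots> = ennreal (4 * t ^ 4)"
    by (simp del: ennreal_half flip: ennreal_mult ennreal_plus)
  finally show ?thesis .
qed

end

section \<open>Clipped products\<close>

text \<open>
  Clipping acts on a block as a single scalar factor, so its effect on entries and on products of
  entries can be read off from bounds on that number.
\<close>

lemma clip_block_eq_scale:
  assumes "finite I" "i \<in> I" "0 \<le> R"
  obtains c where "0 \<le> c" "c \<le> 1" "clip_block R I x i = c * x i" "L2_set x I \<le> R \<Longrightarrow> c = 1"
    "c * L2_set x I \<le> R"
proof (cases "L2_set x I = 0")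
  case True
  then have "x i = 0" using assms by (simp add: L2_set_eq_0_iff)
  with True show ?thesis using that[of 1] assms by (simp add: clip_block_def)
next
  case False
  then have pos: "0 < L2_set x I" using L2_set_nonneg[of x I] by linarith
  show ?thesis
    using pos assms by (intro that[of "min 1 (R / L2_set x I)"])
      (auto simp: clip_block_def min_def field_simps)
qed

lemma abs_clip_block_le:
  assumes "finite I" "i \<in> I" "0 \<le> R"
  shows "\<bar>clip_block R I x i\<bar> \<le> \<bar>x i\<bar>" and "\<bar>clip_block R I x i\<bar> \<le> R"
proof -
  obtain c where c: "0 \<le> c" "c \<le> 1" "clip_block R I x i = c * x i" "c * L2_set x I \<le> R"
    using clip_block_eq_scale[OF assms] by metis
  show "\<bar>clip_block R I x i\<bar> \<le> \<bar>x i\<bar>"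
    using c by (simp add: abs_mult mult_left_le_one_le)
  have "\<bar>x i\<bar> \<le> L2_set x I"
    using member_le_L2_set[of I i "\<lambda>i. \<bar>x i\<bar>"] assms by (simp add: L2_set_def)
  then have "c * \<bar>x i\<bar> \<le> c * L2_set x I"
    using c by (intro mult_left_mono)
  then show "\<bar>clip_block R I x i\<bar> \<le> R"
    using c by (simp add: abs_mult)
qed

lemma clip_block_eq_self:
  assumes "finite I" "i \<in> I" "0 \<le> R" "L2_set x I \<le> R"
  shows "clip_block R I x i = x i"
  using clip_block_eq_scale[OF assms(1-3), of x] assms(4) by (metis mult_1)

context subgaussian_law
begin

lemma measurable_clip_block:
  assumes "I \<subseteq> {1..d}" "i \<in> I"
  shows "(\<lambda>x. clip_block R I x i) \<in> borel_measurable P"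
proof -
  have [measurable]: "(\<lambda>x. x j) \<in> borel_measurable P" if "j \<in> I" for j
    using that assms by auto
  note [measurable] = this[OF assms(2)]
  show ?thesis
    unfolding clip_block_def L2_set_def by measurable
qed

lemma clipped_product_second_moment_le:
  assumes I: "I \<subseteq> {1..d}" "i \<in> I" and J: "J \<subseteq> {1..d}" "j \<in> J" and "0 \<le> R"
  shows "(\<integral>\<^sup>+x. ennreal ((clip_block R I x i * clip_block R J x j)\<^sup>2) \<partial>P) \<le> ennreal (4 * t ^ 4)"
proof -
  have fin: "finite I" "finite J" using I J finite_subset by blast+
  have "(clip_block R I x i * clip_block R J x j)\<^sup>2 \<le> (x i * x j)\<^sup>2" for x
    using abs_clip_block_le(1)[OF fin(1) I(2) \<open>0 \<le> R\<close>, of x]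
      abs_clip_block_le(1)[OF fin(2) J(2) \<open>0 \<le> R\<close>, of x]
    by (intro abs_le_square_iff[THEN iffD1]) (simp add: abs_mult mult_mono)
  then show ?thesis
    using I J by (intro order_trans[OF nn_integral_mono product_second_moment_le[of i j]])
      (auto intro: ennreal_leI)
qed

text \<open>
  The clipped and the true product differ only if one of the two blocks is longer than \<open>R\<close>, and then
  by at most \<open>\<bar>x i * x j\<bar>\<close>. On this exponentially unlikely event the product is split by the
  weighted inequality \<open>y \<le> e / 2 * y\<^sup>2 + 1 / (2 * e)\<close>.
\<close>

lemma clipped_product_bias_le:
  assumes I: "I \<subseteq> {1..d}" "i \<in> I" "card I \<le> k" and J: "J \<subseteq> {1..d}" "j \<in> J" "card J \<le> k"
    and R: "0 \<le> R" "4 * t\<^sup>2 * real k \<le> R\<^sup>2"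
    and int: "integrable P (\<lambda>x. x i * x j)"
  shows "\<bar>expectation (\<lambda>x. clip_block R I x i * clip_block R J x j) - expectation (\<lambda>x. x i * x j)\<bar>
    \<le> 4 * t\<^sup>2 * exp (- real k / 2)"
proof -
  have fin: "finite I" "finite J" using I J finite_subset by blast+
  have coord: "i \<in> {1..d}" "j \<in> {1..d}" using I J by auto
  have mI: "(\<lambda>x. x l) \<in> borel_measurable P" if "l \<in> I" for l using that I(1) by auto
  have mJ: "(\<lambda>x. x l) \<in> borel_measurable P" if "l \<in> J" for l using that J(1) by auto
  note [measurable] = measurable_coord[OF coord(1)] measurable_coord[OF coord(2)]
    measurable_clip_block[OF I(1,2), of R] measurable_clip_block[OF J(1,2), of R]
  let ?Y = "\<lambda>x. clip_block R I x i * clip_block R J x j"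
  let ?AI = "{x \<in> space P. R < L2_set x I}" and ?AJ = "{x \<in> space P. R < L2_set x J}"
  have sets [measurable]: "?AI \<in> sets P" "?AJ \<in> sets P"
    using mI mJ unfolding L2_set_def by measurable
  have intY: "integrable P ?Y"
    using abs_clip_block_le(2)[OF fin(1) I(2) R(1)] abs_clip_block_le(2)[OF fin(2) J(2) R(1)]
    by (intro integrable_const_bound[of _ "R * R"]) (auto simp: abs_mult intro!: AE_I2 mult_mono R)
  \<comment> \<open>This weight makes the moment term and the probability term equal.\<close>
  define e where "e = exp (- real k / 2) / t\<^sup>2"
  have e: "0 < e" using t_pos by (simp add: e_def)
  have pw: "\<bar>?Y x - x i * x j\<bar>
      \<le> e / 2 * (x i * x j)\<^sup>2 + 1 / (2 * e) * (indicator ?AI x + indicator ?AJ x)"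
    if "x \<in> space P" for x
  proof (cases "x \<in> ?AI \<or> x \<in> ?AJ")
    case True
    then have ind: "1 \<le> (indicator ?AI x + indicator ?AJ x :: real)"
      by (auto simp: indicator_def)
    obtain c where c: "0 \<le> c" "c \<le> 1" "clip_block R I x i = c * x i"
      using clip_block_eq_scale[OF fin(1) I(2) R(1)] by metis
    obtain c' where c': "0 \<le> c'" "c' \<le> 1" "clip_block R J x j = c' * x j"
      using clip_block_eq_scale[OF fin(2) J(2) R(1)] by metis
    have "?Y x - x i * x j = (c * c' - 1) * (x i * x j)"
      by (simp add: c c' algebra_simps)
    moreover have "\<bar>c * c' - 1\<bar> \<le> 1"
      using c c' mult_nonneg_nonneg[of c c'] mult_le_one[of c c'] by simp
    ultimately have "\<bar>?Y x - x i * x j\<bar> \<le> \<bar>x i * x j\<bar>"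
      by (metis abs_ge_zero abs_mult mult_left_le_one_le)
    also have "\<dots> \<le> e / 2 * (x i * x j)\<^sup>2 + 1 / (2 * e)"
    proof -
      have "0 \<le> (e * \<bar>x i * x j\<bar> - 1)\<^sup>2 / (2 * e)" using e by simp
      also have "\<dots> = e / 2 * (x i * x j)\<^sup>2 + 1 / (2 * e) - \<bar>x i * x j\<bar>"
        using e by (simp add: power2_diff power_mult_distrib field_simps power2_eq_square)
      finally show ?thesis by simp
    qed
    also have "\<dots> \<le> e / 2 * (x i * x j)\<^sup>2 + 1 / (2 * e) * (indicator ?AI x + indicator ?AJ x)"
      using mult_left_mono[OF ind, of "1 / (2 * e)"] e by simp
    finally show ?thesis .
  next
    case False
    then have "clip_block R I x i = x i" "clip_block R J x j = x j"
      using that by (auto intro!: clip_block_eq_self fin I J R)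
    then show ?thesis using e by simp
  qed
  have "ennreal \<bar>expectation ?Y - expectation (\<lambda>x. x i * x j)\<bar>
      = ennreal \<bar>expectation (\<lambda>x. ?Y x - x i * x j)\<bar>"
    using intY int by simp
  also have "\<dots> \<le> (\<integral>\<^sup>+x. ennreal \<bar>?Y x - x i * x j\<bar> \<partial>P)"
    using integral_norm_bound_ennreal[of P "\<lambda>x. ?Y x - x i * x j"] intY int by simp
  also have "\<dots> \<le> (\<integral>\<^sup>+x. ennreal (e / 2) * ennreal ((x i * x j)\<^sup>2)
      + ennreal (1 / (2 * e)) * (indicator ?AI x + indicator ?AJ x) \<partial>P)"
  proof (intro nn_integral_mono)
    fix x assume x: "x \<in> space P"
    have "ennreal \<bar>?Y x - x i * x j\<bar>
      \<le> ennreal (e / 2 * (x i * x j)\<^sup>2 + 1 / (2 * e) * (indicator ?AI x + indicator ?AJ x))"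
      by (rule ennreal_leI[OF pw[OF x]])
    also have "\<dots> = ennreal (e / 2) * ennreal ((x i * x j)\<^sup>2)
      + ennreal (1 / (2 * e)) * (indicator ?AI x + indicator ?AJ x)"
      using e by (simp add: ennreal_mult ennreal_plus del: times_divide_eq_left times_divide_eq_right flip: ennreal_indicator)
    finally show "ennreal \<bar>?Y x - x i * x j\<bar> \<le> ennreal (e / 2) * ennreal ((x i * x j)\<^sup>2)
      + ennreal (1 / (2 * e)) * (indicator ?AI x + indicator ?AJ x)" .
  qed
  also have "\<dots> = ennreal (e / 2) * (\<integral>\<^sup>+x. ennreal ((x i * x j)\<^sup>2) \<partial>P)
      + ennreal (1 / (2 * e)) * (emeasure P ?AI + emeasure P ?AJ)"
    using sets by (simp add: nn_integral_add nn_integral_cmult)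
  also have "\<dots> \<le> ennreal (e / 2) * ennreal (4 * t ^ 4)
      + ennreal (1 / (2 * e)) * (ennreal (2 * exp (- real k)) + ennreal (2 * exp (- real k)))"
    by (intro add_mono mult_left_mono product_second_moment_le emeasure_norm_gt_le coord I J R) auto
  also have "\<dots> = ennreal (e / 2 * (4 * t ^ 4) + 1 / (2 * e) * (4 * exp (- real k)))"
    using e by (simp flip: ennreal_mult ennreal_plus)
  also have "e / 2 * (4 * t ^ 4) + 1 / (2 * e) * (4 * exp (- real k)) = 4 * t\<^sup>2 * exp (- real k / 2)"
  proof -
    have "exp (- real k) = exp (- real k / 2) * exp (- real k / 2)"
      by (simp flip: exp_add)
    then show ?thesis
      using t_pos by (simp add: e_def field_simps eval_nat_numeral)
  qed
  finally show ?thesis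
    by (subst (asm) ennreal_le_iff) simp_all
qed

end

section \<open>Mean square error of an i.i.d. average\<close>

text \<open>
  The centred summands \<open>g (X s)\<close> are orthogonal in \<open>L\<^sup>2\<close> of the product measure, so after expanding
  the square only the diagonal terms survive.
\<close>

lemma (in prob_space) iid_mean_square_error_le:
  fixes f :: "'a \<Rightarrow> real"
  assumes [measurable]: "f \<in> borel_measurable M" and bounded: "\<And>x. \<bar>f x\<bar> \<le> B"
    and S: "finite S" "S \<noteq> {}"
  shows "(\<integral>\<^sup>+X. ennreal (((\<Sum>s\<in>S. f (X s)) / real (card S) - expectation f)\<^sup>2) \<partial>(\<Pi>\<^sub>M s\<in>S. M))
    \<le> ennreal (expectation (\<lambda>x. (f x)\<^sup>2) / real (card S))"
proof -
  let ?P = "\<Pi>\<^sub>M s\<in>S. M"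
  interpret S: product_prob_space "\<lambda>_. M" S ..
  have n: "0 < card S" using S by (simp add: card_gt_0_iff)
  define g where "g x = f x - expectation f" for x
  have [measurable]: "g \<in> borel_measurable M" unfolding g_def by measurable
  have intf: "integrable M f"
    using bounded by (intro integrable_const_bound[of _ B]) auto
  have intf2: "integrable M (\<lambda>x. (f x)\<^sup>2)"
    using bounded power_mono[of "\<bar>f _\<bar>" B 2] by (intro integrable_const_bound[of _ "B\<^sup>2"]) auto
  have g0: "expectation g = 0"
    using intf by (simp add: g_def[abs_def] prob_space)
  have g2: "expectation (\<lambda>x. g x * g x) \<le> expectation (\<lambda>x. (f x)\<^sup>2)"
    using variance_eq[OF intf intf2] by (simp add: g_def power2_eq_square)
  define G where "G = B + \<bar>expectation f\<bar>"
  have gB: "\<bar>g x\<bar> \<le> G" for x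
    using bounded[of x] by (simp add: g_def G_def)
  then have "0 \<le> G"
    using order_trans[OF abs_ge_zero] by blast
  then have gg: "norm (g x * g y) \<le> G * G" for x y
    by (auto simp: abs_mult intro!: mult_mono gB)
  have intg: "integrable M g"
    using gB by (intro integrable_const_bound[of _ G]) auto
  have intg2: "integrable M (\<lambda>x. g x * g x)"
    by (intro integrable_const_bound[of _ "G * G"] AE_I2 gg) simp
  have cov: "(LINT X|?P. g (X s) * g (X u)) = (if s = u then expectation (\<lambda>x. g x * g x) else 0)"
    if su: "s \<in> S" "u \<in> S" for s u
  proof -
    \<comment> \<open>This form writes the product of two summands as a product over all coordinates, also when \<open>s = u\<close>.\<close>
    define h where "h v x = (if v = s then g x else 1) * (if v = u then g x else 1)" for v x
    have "(\<lambda>X. g (X s) * g (X u)) = (\<lambda>X. \<Prod>v\<in>S. h v (X v))"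
      using su S by (simp add: h_def prod.distrib prod.delta)
    moreover have "(LINT X|?P. (\<Prod>v\<in>S. h v (X v))) = (\<Prod>v\<in>S. expectation (h v))"
    proof (intro S.product_integral_prod S)
      show "integrable M (h v)" for v
        by (cases "v = s"; cases "v = u") (simp_all add: h_def[abs_def] intg intg2)
    qed
    moreover have "(\<Prod>v\<in>S. expectation (h v)) = (if s = u then expectation (\<lambda>x. g x * g x) else 0)"
    proof (cases "s = u")
      case True
      then have "expectation (h v) = (if v = s then expectation (\<lambda>x. g x * g x) else 1)" for v
        by (simp add: h_def[abs_def] prob_space)
      then show ?thesis using True su S by (simp add: prod.delta)
    next
      case False
      then have "expectation (h s) = 0"
        by (simp add: h_def[abs_def] g0)
      then have "(\<Prod>v\<in>S. expectation (h v)) = 0"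
        using su S by (intro prod_zero) auto
      then show ?thesis using False by simp
    qed
    ultimately show ?thesis by simp
  qed
  have intgg: "integrable ?P (\<lambda>X. g (X s) * g (X u))" if "s \<in> S" "u \<in> S" for s u
    using gg that by (intro S.P.integrable_const_bound[of _ "G * G"]) auto
  have sq: "((\<Sum>s\<in>S. f (X s)) / real (card S) - expectation f)\<^sup>2
      = (\<Sum>s\<in>S. \<Sum>u\<in>S. g (X s) * g (X u)) / (real (card S))\<^sup>2" for X
  proof -
    have "(\<Sum>s\<in>S. f (X s)) / real (card S) - expectation f = (\<Sum>s\<in>S. g (X s)) / real (card S)"
      using n by (simp add: g_def sum_subtractf field_simps)
    then show ?thesis
      by (simp only: power_divide power2_eq_square[of "sum _ _"] sum_product)
  qed
  have "(\<integral>\<^sup>+X. ennreal (((\<Sum>s\<in>S. f (X s)) / real (card S) - expectation f)\<^sup>2) \<partial>?P)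
      = ennreal (LINT X|?P. ((\<Sum>s\<in>S. f (X s)) / real (card S) - expectation f)\<^sup>2)"
  proof (intro nn_integral_eq_integral)
    show "integrable ?P (\<lambda>X. ((\<Sum>s\<in>S. f (X s)) / real (card S) - expectation f)\<^sup>2)"
      unfolding sq by (intro integrable_divide_zero Bochner_Integration.integrable_sum intgg)
  qed simp
  also have "(LINT X|?P. ((\<Sum>s\<in>S. f (X s)) / real (card S) - expectation f)\<^sup>2)
      = (\<Sum>s\<in>S. \<Sum>u\<in>S. (LINT X|?P. g (X s) * g (X u))) / (real (card S))\<^sup>2"
    unfolding sq by (simp add: Bochner_Integration.integral_sum Bochner_Integration.integrable_sum intgg)
  also have "\<dots> = expectation (\<lambda>x. g x * g x) / real (card S)"
    using n S by (simp add: cov power2_eq_square)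
  also have "ennreal \<dots> \<le> ennreal (expectation (\<lambda>x. (f x)\<^sup>2) / real (card S))"
    using g2 by (intro ennreal_leI divide_right_mono) auto
  finally show ?thesis .
qed

section \<open>Entries of the estimator\<close>

definition block_index :: "nat \<Rightarrow> nat \<Rightarrow> nat" where
  "block_index k i = (i - 1) div k + 1"

lemma mem_block_interval_iff:
  assumes "1 \<le> k" "1 \<le> i"
  shows "i \<in> block_interval k l \<longleftrightarrow> l = block_index k i"
proof (cases l)
  case 0
  then show ?thesis using assms by (simp add: block_interval_def block_index_def)
next
  case (Suc m)
  have "i \<in> block_interval k l \<longleftrightarrow> m * k \<le> i - 1 \<and> i - 1 < Suc m * k"
    using assms by (auto simp: block_interval_def Suc)
  also have "\<dots> \<longleftrightarrow> m = (i - 1) div k"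
    using assms by (auto simp: div_nat_eqI mult.commute dividend_less_times_div)
  finally show ?thesis by (simp add: block_index_def Suc)
qed

lemma card_block_interval: "1 \<le> l \<Longrightarrow> card (block_interval k l) = k"
  by (cases l) (auto simp: block_interval_def)

lemma block_index_mono: "i \<le> j \<Longrightarrow> block_index k i \<le> block_index k j"
  by (simp add: block_index_def div_le_mono)

text \<open>
  Two neighbouring blocks span \<open>2 * k\<close> consecutive indices, whereas two blocks that are not
  neighbours are separated by a whole block. The estimator therefore treats every entry at
  distance at most \<open>k\<close> from the diagonal and none at distance \<open>2 * k\<close> or more.
\<close>

lemma block_index_near_imp:
  assumes "1 \<le> k" "1 \<le> i" "i \<le> j" "block_index k j \<le> block_index k i + 1"
  shows "j < i + 2 * k"
proof -
  have "i \<in> block_interval k (block_index k i)" "j \<in> block_interval k (block_index k j)"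
    using assms by (auto simp: mem_block_interval_iff)
  then have "Suc ((block_index k i - 1) * k) \<le> i" "j \<le> block_index k j * k"
    by (auto simp: block_interval_def)
  moreover have "block_index k j * k \<le> (block_index k i - 1) * k + 2 * k"
    using assms mult_le_mono1[OF assms(4), of k] by (simp add: block_index_def algebra_simps)
  ultimately show ?thesis by simp
qed

lemma block_index_far_imp:
  assumes "1 \<le> k" "1 \<le> i" "i \<le> j" "block_index k i + 1 < block_index k j"
  shows "i + k < j"
proof -
  have "i \<in> block_interval k (block_index k i)" "j \<in> block_interval k (block_index k j)"
    using assms by (auto simp: mem_block_interval_iff)
  then have "i \<le> block_index k i * k" "(block_index k j - 1) * k < j"
    by (auto simp: block_interval_def)
  moreover have "(block_index k i + 1) * k \<le> (block_index k j - 1) * k"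
    using assms by (intro mult_le_mono1) simp
  ultimately show ?thesis by simp
qed

lemma dp_cov_tri_commute: "dp_cov_tri n D k \<rho> R X w i j = dp_cov_tri n D k \<rho> R X w j i"
  by (auto simp: dp_cov_tri_def Let_def)

lemma near_block_mem_tri_blocks:
  assumes "1 \<le> i" "i \<le> j" "j \<le> N * k" "block_index k j \<le> block_index k i + 1"
  shows "(block_index k i, block_index k j - block_index k i) \<in> tri_blocks N"
proof -
  have "(j - 1) div k < N"
    using assms by (intro less_mult_imp_div_less) simp
  then have "block_index k j \<le> N" by (simp add: block_index_def)
  moreover have "block_index k i \<le> block_index k j"
    using assms by (intro block_index_mono)
  moreover have "block_index k j - block_index k i = 0 \<or> block_index k j - block_index k i = 1"
    using assms(4) by arith
  ultimately show ?thesis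
    by (auto simp: tri_blocks_def block_index_def)
qed

lemma finite_tri_blocks: "finite (tri_blocks N)"
  by (rule finite_subset[of _ "{..N} \<times> {0, 1}"]) (auto simp: tri_blocks_def)

text \<open>
  At most one block contains the position \<open>(i, j)\<close> with \<open>i \<le> j\<close>, so the sum over all blocks has
  at most one non-zero term.
\<close>

lemma dp_cov_tri_eq:
  assumes k: "1 \<le> k" and ij: "1 \<le> i" "i \<le> j" "j \<le> N * k"
  shows "dp_cov_tri n (N * k) k \<rho> R X w i j =
    (if block_index k j \<le> block_index k i + 1
     then (\<Sum>s\<in>{1..n}. clip_block R (block_interval k (block_index k i)) (X s) i
             * clip_block R (block_interval k (block_index k j)) (X s) j) / real n
          + sqrt (18 * R ^ 4 / (\<rho> / (2 * real N) * (real n)\<^sup>2))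
            * w (block_index k i, block_index k j - block_index k i, i, j)
     else 0)"
    (is "_ = (if _ then ?E else 0)")
proof -
  let ?p = "block_index k i" and ?q = "block_index k j"
  let ?t = "\<lambda>(l, r). dp_cov_block n X (block_interval k l) (block_interval k (l + r))
              (\<rho> / (2 * real N)) R (sym_noise w l r) i j"
  have zero: "?t (l, r) = 0" if "(l, r) \<noteq> (?p, ?q - ?p)" for l r
    using that k ij by (auto simp: dp_cov_block_def mem_block_interval_iff)
  have eq: "dp_cov_tri n (N * k) k \<rho> R X w i j = sum ?t (tri_blocks N)"
    using k ij by (simp add: dp_cov_tri_def Let_def)
  have le: "?p \<le> ?q" using ij by (rule_tac block_index_mono)
  show ?thesis
  proof (cases "?q \<le> ?p + 1")
    case True
    have "(?p, ?q - ?p) \<in> tri_blocks N"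
      using near_block_mem_tri_blocks[OF ij True] .
    then have "sum ?t (tri_blocks N) = sum ?t {(?p, ?q - ?p)}"
      using zero by (intro sum.mono_neutral_right finite_tri_blocks) auto
    also have "\<dots> = ?E"
      using le ij k by (simp add: dp_cov_block_def mem_block_interval_iff sym_noise_def)
    finally show ?thesis using True eq by simp
  next
    case False
    have "?t x = 0" if "x \<in> tri_blocks N" for x
    proof -
      obtain l r where x: "x = (l, r)" by (cases x)
      then have "(l, r) \<noteq> (?p, ?q - ?p)"
        using that False by (auto simp: tri_blocks_def)
      then show ?thesis unfolding x by (rule zero)
    qed
    then show ?thesis using False eq by (simp add: sum.neutral)
  qed
qed

text \<open>
  Padding zeros do not change norms, so every block may be cut down to the original coordinates.
\<close>

lemma clip_block_pad_vec:
  assumes "finite I" "i \<in> {1..d}"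
  shows "clip_block R I (pad_vec d x) i = clip_block R (I \<inter> {1..d}) x i"
proof -
  have "(\<Sum>i\<in>I. (pad_vec d x i)\<^sup>2) = (\<Sum>i\<in>I \<inter> {1..d}. (x i)\<^sup>2)"
    using assms by (intro sum.mono_neutral_cong_right) (auto simp: pad_vec_def)
  then have "L2_set (pad_vec d x) I = L2_set x (I \<inter> {1..d})"
    by (simp add: L2_set_def)
  then show ?thesis
    using assms by (simp add: clip_block_def pad_vec_def)
qed

text \<open>
  Minimality of the exponent in the padding means that padding less than doubles the dimension,
  unless a single block already covers everything.
\<close>

lemma padded_dim_cases:
  assumes "1 \<le> k"
  obtains N where "padded_dim d k = N * k" "d \<le> N * k" "1 \<le> N" "N = 1 \<or> N * k < 2 * d"
proof -
  define J where "J = (LEAST J. d \<le> 2 ^ J * k)"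
  have "d \<le> 2 ^ d * k"
    using assms less_exp[of d] by (metis le_trans less_imp_le mult_le_mono2 mult.right_neutral)
  then have J: "d \<le> 2 ^ J * k"
    unfolding J_def by (rule LeastI)
  have "(2::nat) ^ J = 1 \<or> 2 ^ J * k < 2 * d"
  proof (cases J)
    case (Suc J')
    then have "\<not> d \<le> 2 ^ J' * k"
      using not_less_Least[of J' "\<lambda>J. d \<le> 2 ^ J * k"] by (simp add: J_def)
    then show ?thesis by (simp add: Suc)
  qed simp
  with J show ?thesis
    using that[of "2 ^ J"] by (simp add: padded_dim_def flip: J_def)
qed

section \<open>Risk of a single entry\<close>

lemma prob_space_noise: "prob_space (noise_space D k)"
  unfolding noise_space_def by (intro prob_space_PiM prob_space_std_normal)

lemma noise_second_moment:
  assumes "(l, r) \<in> tri_blocks (D div k)" "1 \<le> i" "i \<le> j" "j \<le> D"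
  shows "(\<lambda>w. w (l, r, i, j)) \<in> borel_measurable (noise_space D k)"
    and "(\<integral>\<^sup>+w. ennreal ((w (l, r, i, j))\<^sup>2) \<partial>noise_space D k) = 1"
proof -
  let ?Q = "{(l, r, i, j). (l, r) \<in> tri_blocks (D div k) \<and> 1 \<le> i \<and> i \<le> j \<and> j \<le> D}"
  have mem: "(l, r, i, j) \<in> ?Q" using assms by simp
  have meas: "(\<lambda>w. w (l, r, i, j)) \<in> measurable (noise_space D k) std_normal"
    unfolding noise_space_def by (rule measurable_component_singleton[OF mem])
  then show "(\<lambda>w. w (l, r, i, j)) \<in> borel_measurable (noise_space D k)"
    by (simp cong: measurable_cong_sets)
  have "distr (noise_space D k) std_normal (\<lambda>w. w (l, r, i, j)) = std_normal"
    unfolding noise_space_def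
    by (rule distr_PiM_component[OF _ mem, where M = "\<lambda>_. std_normal"]) (rule prob_space_std_normal)
  then have "(\<integral>\<^sup>+w. ennreal ((w (l, r, i, j))\<^sup>2) \<partial>noise_space D k) = (\<integral>\<^sup>+g. ennreal (g\<^sup>2) \<partial>std_normal)"
    using nn_integral_distr[OF meas, of "\<lambda>g. ennreal (g\<^sup>2)"] by simp
  then show "(\<integral>\<^sup>+w. ennreal ((w (l, r, i, j))\<^sup>2) \<partial>noise_space D k) = 1"
    by (simp add: nn_integral_std_normal_square)
qed

text \<open>
  Only \<open>(p + q + r)\<^sup>2 \<le> 3 * (p\<^sup>2 + q\<^sup>2 + r\<^sup>2)\<close> is used here; the lost factor affects constants
  alone and saves the computation of the cross terms.
\<close>

lemma nn_integral_pair_square_sum_le: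
  fixes A :: "'a \<Rightarrow> real" and Z :: "'b \<Rightarrow> real"
  assumes M: "prob_space M" and N: "prob_space N"
    and [measurable]: "A \<in> borel_measurable M" "Z \<in> borel_measurable N"
  shows "(\<integral>\<^sup>+(x, y). ennreal ((A x + Z y + b)\<^sup>2) \<partial>(M \<Otimes>\<^sub>M N))
    \<le> 3 * ((\<integral>\<^sup>+x. ennreal ((A x)\<^sup>2) \<partial>M) + (\<integral>\<^sup>+y. ennreal ((Z y)\<^sup>2) \<partial>N) + ennreal (b\<^sup>2))"
proof -
  interpret M: prob_space M by (rule M)
  interpret N: prob_space N by (rule N)
  interpret pair_prob_space M N ..
  have sq: "(p + q + r)\<^sup>2 \<le> 3 * (p\<^sup>2 + q\<^sup>2 + r\<^sup>2)" for p q r :: real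
    using sum_squares_bound[of p q] sum_squares_bound[of p r] sum_squares_bound[of q r]
    by (simp add: power2_sum algebra_simps)
  have fst: "(\<integral>\<^sup>+z. ennreal ((A (fst z))\<^sup>2) \<partial>(M \<Otimes>\<^sub>M N)) = (\<integral>\<^sup>+x. ennreal ((A x)\<^sup>2) \<partial>M)"
    by (subst N.nn_integral_fst[symmetric]) (simp_all add: N.emeasure_space_1)
  have snd: "(\<integral>\<^sup>+z. ennreal ((Z (snd z))\<^sup>2) \<partial>(M \<Otimes>\<^sub>M N)) = (\<integral>\<^sup>+y. ennreal ((Z y)\<^sup>2) \<partial>N)"
    by (subst N.nn_integral_fst[symmetric]) (simp_all add: M.emeasure_space_1)
  have "(\<integral>\<^sup>+(x, y). ennreal ((A x + Z y + b)\<^sup>2) \<partial>(M \<Otimes>\<^sub>M N))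
    \<le> (\<integral>\<^sup>+z. 3 * (ennreal ((A (fst z))\<^sup>2) + ennreal ((Z (snd z))\<^sup>2) + ennreal (b\<^sup>2)) \<partial>(M \<Otimes>\<^sub>M N))"
  proof (rule nn_integral_mono)
    fix z
    have "ennreal ((A (fst z) + Z (snd z) + b)\<^sup>2) \<le> ennreal (3 * ((A (fst z))\<^sup>2 + (Z (snd z))\<^sup>2 + b\<^sup>2))"
      by (rule ennreal_leI[OF sq])
    then show "(case z of (x, y) \<Rightarrow> ennreal ((A x + Z y + b)\<^sup>2))
      \<le> 3 * (ennreal ((A (fst z))\<^sup>2) + ennreal ((Z (snd z))\<^sup>2) + ennreal (b\<^sup>2))"
      by (simp add: case_prod_beta ennreal_mult ennreal_plus)
  qed
  also have "\<dots> = 3 * ((\<integral>\<^sup>+x. ennreal ((A x)\<^sup>2) \<partial>M) + (\<integral>\<^sup>+y. ennreal ((Z y)\<^sup>2) \<partial>N) + ennreal (b\<^sup>2))"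
    by (simp add: nn_integral_cmult nn_integral_add fst snd emeasure_space_1)
  finally show ?thesis .
qed

definition tri_error ::
  "nat \<Rightarrow> nat \<Rightarrow> nat \<Rightarrow> real \<Rightarrow> real \<Rightarrow> rmat \<Rightarrow> nat \<Rightarrow> nat \<Rightarrow> (nat \<Rightarrow> rvec) \<times> noise \<Rightarrow> real" where
  "tri_error n d k \<rho> R S i j = (\<lambda>(X, w).
     dp_cov_tri n (padded_dim d k) k \<rho> R (\<lambda>s. pad_vec d (X s)) w i j - S i j)"

context subgaussian_law
begin

text \<open>
  The error of an entry inside a block is the sum of the fluctuation \<open>A\<close> of the empirical mean, the
  privacy noise \<open>Z\<close> and the clipping bias \<open>b\<close>; outside the blocks the estimate is \<open>0\<close> and the error
  is the covariance itself. It suffices to treat \<open>i \<le> j\<close>, because estimator and covariance matrix are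
  symmetric.
\<close>

lemma tri_error_upper:
  assumes k: "1 \<le> k" and n: "1 \<le> n" and \<rho>: "0 < \<rho>"
    and R: "0 \<le> R" "4 * t\<^sup>2 * real k \<le> R\<^sup>2"
    and ij: "1 \<le> i" "i \<le> j" "j \<le> d"
    and int: "integrable P (\<lambda>x. x i * x j)" and S: "S i j = expectation (\<lambda>x. x i * x j)"
    and N: "padded_dim d k = N * k" "d \<le> N * k" "1 \<le> N"
  shows "tri_error n d k \<rho> R S i j \<in> borel_measurable (sample_space n d k P)"
    and "block_index k j \<le> block_index k i + 1 \<Longrightarrow>
      (\<integral>\<^sup>+z. ennreal ((tri_error n d k \<rho> R S i j z)\<^sup>2) \<partial>sample_space n d k P)
        \<le> ennreal (3 * (4 * t ^ 4 / real n + 36 * R ^ 4 * real N / (\<rho> * (real n)\<^sup>2)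
            + 16 * t ^ 4 * exp (- real k)))"
    and "block_index k i + 1 < block_index k j \<Longrightarrow>
      (\<integral>\<^sup>+z. ennreal ((tri_error n d k \<rho> R S i j z)\<^sup>2) \<partial>sample_space n d k P) = ennreal ((S i j)\<^sup>2)"
proof -
  let ?p = "block_index k i" and ?q = "block_index k j"
  define I where "I = block_interval k ?p \<inter> {1..d}"
  define J where "J = block_interval k ?q \<inter> {1..d}"
  define Y where "Y x = clip_block R I x i * clip_block R J x j" for x
  define \<sigma> where "\<sigma> = sqrt (18 * R ^ 4 / (\<rho> / (2 * real N) * (real n)\<^sup>2))"
  define A where "A X = (\<Sum>s\<in>{1..n}. Y (X s)) / real n - expectation Y" for X :: "nat \<Rightarrow> rvec"
  define Z where "Z w = \<sigma> * w (?p, ?q - ?p, i, j)" for w :: noise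
  define b where "b = expectation Y - S i j"
  have pq: "?p \<le> ?q" using ij by (rule_tac block_index_mono)
  have coord: "i \<in> {1..d}" "j \<in> {1..d}" using ij by auto
  have I: "I \<subseteq> {1..d}" "i \<in> I" "card I \<le> k" and J: "J \<subseteq> {1..d}" "j \<in> J" "card J \<le> k"
    using k ij card_mono[of "block_interval k ?p" I] card_mono[of "block_interval k ?q" J]
      card_block_interval[of ?p k] card_block_interval[of ?q k]
    by (auto simp: I_def J_def mem_block_interval_iff) (auto simp: block_interval_def block_index_def)
  have fin: "finite I" "finite J" by (auto simp: I_def J_def)
  have err: "tri_error n d k \<rho> R S i j = (\<lambda>(X, w). if ?q \<le> ?p + 1 then A X + Z w + b else - S i j)"
    using k ij N unfolding tri_error_def N(1)
    by (subst dp_cov_tri_eq)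
       (auto simp: clip_block_pad_vec block_interval_def[abs_def] coord fun_eq_iff
          A_def Z_def b_def Y_def I_def J_def \<sigma>_def)
  have Ym [measurable]: "Y \<in> borel_measurable P"
    unfolding Y_def[abs_def] using I J by (intro borel_measurable_times measurable_clip_block) auto
  have Yb: "\<bar>Y x\<bar> \<le> R * R" for x
    unfolding Y_def abs_mult using I J R by (intro mult_mono abs_clip_block_le fin) auto
  let ?S = "\<Pi>\<^sub>M s\<in>{1..n}. P" and ?W = "noise_space (padded_dim d k) k"
  have S_prob: "prob_space ?S" by (intro prob_space_PiM prob_space_axioms)
  have Am [measurable]: "A \<in> borel_measurable ?S"
    unfolding A_def by measurable
  have near: "(?p, ?q - ?p) \<in> tri_blocks (padded_dim d k div k)" if "?q \<le> ?p + 1"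
    using near_block_mem_tri_blocks[of i j N k] that ij k N by simp
  have jD: "j \<le> padded_dim d k" using ij N by simp
  show "tri_error n d k \<rho> R S i j \<in> borel_measurable (sample_space n d k P)"
  proof (cases "?q \<le> ?p + 1")
    case True
    note [measurable] = noise_second_moment(1)[OF near[OF True] ij(1,2) jD]
    have [measurable]: "Z \<in> borel_measurable ?W"
      unfolding Z_def by measurable
    show ?thesis
      using True unfolding err sample_space_def case_prod_beta by (simp del: One_nat_def)
  qed (simp add: err case_prod_beta)
  show "(\<integral>\<^sup>+z. ennreal ((tri_error n d k \<rho> R S i j z)\<^sup>2) \<partial>sample_space n d k P) = ennreal ((S i j)\<^sup>2)"
    if "?p + 1 < ?q"
  proof -
    interpret SP: prob_space ?S by (rule S_prob)
    interpret W: prob_space ?W by (rule prob_space_noise)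
    interpret SW: pair_prob_space ?S ?W ..
    show ?thesis
      using that by (simp add: err case_prod_beta sample_space_def SW.P.emeasure_space_1 del: One_nat_def)
  qed
  show "(\<integral>\<^sup>+z. ennreal ((tri_error n d k \<rho> R S i j z)\<^sup>2) \<partial>sample_space n d k P)
        \<le> ennreal (3 * (4 * t ^ 4 / real n + 36 * R ^ 4 * real N / (\<rho> * (real n)\<^sup>2)
            + 16 * t ^ 4 * exp (- real k)))"
    if q: "?q \<le> ?p + 1"
  proof -
    note noise = noise_second_moment[OF near[OF q] ij(1,2) jD]
    note [measurable] = noise(1)
    have Zm: "Z \<in> borel_measurable ?W"
      unfolding Z_def by measurable
    have "(\<integral>\<^sup>+X. ennreal ((A X)\<^sup>2) \<partial>?S) \<le> ennreal (expectation (\<lambda>x. (Y x)\<^sup>2) / real n)"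
      using iid_mean_square_error_le[OF Ym Yb, of "{1..n}"] n by (simp add: A_def)
    also have "\<dots> \<le> ennreal (4 * t ^ 4 / real n)"
    proof -
      have "integrable P (\<lambda>x. (Y x)\<^sup>2)"
        using Yb power_mono[of "\<bar>Y _\<bar>" "R * R" 2]
        by (intro integrable_const_bound[of _ "(R * R)\<^sup>2"]) auto
      then have "ennreal (expectation (\<lambda>x. (Y x)\<^sup>2)) = (\<integral>\<^sup>+x. ennreal ((Y x)\<^sup>2) \<partial>P)"
        by (intro nn_integral_eq_integral[symmetric]) auto
      also have "\<dots> \<le> ennreal (4 * t ^ 4)"
        unfolding Y_def by (rule clipped_product_second_moment_le[OF I(1,2) J(1,2) R(1)])
      finally have "expectation (\<lambda>x. (Y x)\<^sup>2) \<le> 4 * t ^ 4"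
        by (subst (asm) ennreal_le_iff) auto
      then show ?thesis by (intro ennreal_leI divide_right_mono) auto
    qed
    finally have variance: "(\<integral>\<^sup>+X. ennreal ((A X)\<^sup>2) \<partial>?S) \<le> ennreal (4 * t ^ 4 / real n)" .
    have "(\<integral>\<^sup>+w. ennreal ((Z w)\<^sup>2) \<partial>?W) = ennreal (\<sigma>\<^sup>2) * (\<integral>\<^sup>+w. ennreal ((w (?p, ?q - ?p, i, j))\<^sup>2) \<partial>?W)"
      by (subst nn_integral_cmult[symmetric]) (auto simp: Z_def power_mult_distrib simp flip: ennreal_mult)
    then have "(\<integral>\<^sup>+w. ennreal ((Z w)\<^sup>2) \<partial>?W) = ennreal (\<sigma>\<^sup>2)"
      by (simp add: noise(2))
    also have "\<sigma>\<^sup>2 = 36 * R ^ 4 * real N / (\<rho> * (real n)\<^sup>2)"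
      using \<rho> N unfolding \<sigma>_def by (subst real_sqrt_pow2) (auto simp: field_simps)
    finally have privacy: "(\<integral>\<^sup>+w. ennreal ((Z w)\<^sup>2) \<partial>?W) = ennreal (36 * R ^ 4 * real N / (\<rho> * (real n)\<^sup>2))" .
    have "\<bar>b\<bar> \<le> 4 * t\<^sup>2 * exp (- real k / 2)"
      unfolding b_def S Y_def[abs_def] by (rule clipped_product_bias_le[OF I J R int])
    then have "b\<^sup>2 \<le> (4 * t\<^sup>2 * exp (- real k / 2))\<^sup>2"
      by (rule abs_le_square_iff[THEN iffD1, OF order_trans]) simp
    also have "\<dots> = 16 * t ^ 4 * exp (- real k)"
      by (simp add: power_mult_distrib flip: exp_double power_mult)
    finally have bias: "ennreal (b\<^sup>2) \<le> ennreal (16 * t ^ 4 * exp (- real k))"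
      by (rule ennreal_leI)
    have "(\<integral>\<^sup>+z. ennreal ((tri_error n d k \<rho> R S i j z)\<^sup>2) \<partial>sample_space n d k P)
        = (\<integral>\<^sup>+(X, w). ennreal ((A X + Z w + b)\<^sup>2) \<partial>(?S \<Otimes>\<^sub>M ?W))"
      unfolding err sample_space_def using q by (intro nn_integral_cong) (auto simp: case_prod_beta)
    also have "\<dots> \<le> 3 * ((\<integral>\<^sup>+X. ennreal ((A X)\<^sup>2) \<partial>?S) + (\<integral>\<^sup>+w. ennreal ((Z w)\<^sup>2) \<partial>?W) + ennreal (b\<^sup>2))"
      by (rule nn_integral_pair_square_sum_le[OF S_prob prob_space_noise Am Zm])
    also have "\<dots> \<le> 3 * (ennreal (4 * t ^ 4 / real n) + ennreal (36 * R ^ 4 * real N / (\<rho> * (real n)\<^sup>2))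
        + ennreal (16 * t ^ 4 * exp (- real k)))"
      unfolding privacy by (intro mult_left_mono add_mono variance bias order_refl) auto
    also have "\<dots> = ennreal (3 * (4 * t ^ 4 / real n + 36 * R ^ 4 * real N / (\<rho> * (real n)\<^sup>2)
        + 16 * t ^ 4 * exp (- real k)))"
    proof -
      have "3 * (ennreal x + ennreal y + ennreal z) = ennreal (3 * (x + y + z))"
        if "0 \<le> x" "0 \<le> y" "0 \<le> z" for x y z
        using that by (simp add: ennreal_mult)
      then show ?thesis using \<rho> R t_pos by simp
    qed
    finally show ?thesis .
  qed
qed

end

section \<open>From the psi-2 norm to a subgaussian law\<close>

lemma data_law_subgaussian:
  assumes P: "data_law d K S P" and K: "0 < K" "K < t"
  shows "subgaussian_law P d t"
proof -
  interpret prob_space P using P by (simp add: data_law_def)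
  show ?thesis
  proof
    show "sets P = sets (vec_space d)" using P by (simp add: data_law_def)
    show "0 < t" using K by simp
    fix v :: rvec assume v: "L2_set v {1..d} = 1"
    let ?I = "\<lambda>t. \<integral>\<^sup>+x. ennreal (exp ((inner_upto d x v)\<^sup>2 / t\<^sup>2)) \<partial>P"
    have "(INF t\<in>{t. 0 < t \<and> ?I t \<le> 2}. ennreal t) \<le> psi2_norm d P"
      using v unfolding psi2_norm_def by (intro SUP_upper) simp
    also have "\<dots> \<le> ennreal K" using P by (simp add: data_law_def)
    also have "\<dots> < ennreal t" using K by (simp add: ennreal_lessI)
    finally obtain s where s: "0 < s" "?I s \<le> 2" "ennreal s < ennreal t"
      unfolding INF_less_iff by auto
    then have "s\<^sup>2 \<le> t\<^sup>2"
      by (intro power_mono) (auto simp: ennreal_less_iff)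
    then have "?I t \<le> ?I s"
      using s(1) by (intro nn_integral_mono ennreal_leI) (auto intro!: divide_left_mono simp: zero_less_mult_iff zero_less_power2)
    with s(2) show "?I t \<le> 2" by simp
  qed
qed

lemma data_law_covariance:
  assumes "data_law d K S P" "i \<in> {1..d}" "j \<in> {1..d}"
  shows "integrable P (\<lambda>x. x i * x j)" and "S i j = (\<integral>x. x i * x j \<partial>P)"
  using assms by (auto simp: data_law_def is_covariance_def)

section \<open>Summing over the matrix\<close>

text \<open>
  The sum is compared with a telescoping one: from
  \<open>1 + 1 / m \<le> (1 + 1 / m) powr s\<close> it follows that the term at \<open>m + 1\<close> is at most
  \<open>m powr (- s) - (m + 1) powr (- s)\<close>.
\<close>

lemma sum_inverse_powr_tail_le:
  fixes s :: real
  assumes "1 \<le> s" "1 \<le> k"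
  shows "(\<Sum>m\<in>{k<..n}. real m powr (- (s + 1))) \<le> real k powr (- s)"
proof -
  have step: "real (Suc m) powr (- (s + 1)) \<le> real m powr (- s) - real (Suc m) powr (- s)"
    if "1 \<le> m" for m
  proof -
    let ?y = "real (Suc m)"
    have "1 + 1 / real m = ?y / real m" using that by (simp add: field_simps)
    also have "\<dots> \<le> (?y / real m) powr s"
      using that assms powr_mono[of 1 s "?y / real m"] by simp
    finally have "?y powr (- s) * (1 / real m) \<le> ?y powr (- s) * ((?y / real m) powr s - 1)"
      by (intro mult_left_mono) auto
    also have "\<dots> = real m powr (- s) - ?y powr (- s)"
      using that by (simp add: powr_divide powr_minus field_simps)
    finally have *: "?y powr (- s) * (1 / real m) \<le> real m powr (- s) - ?y powr (- s)" .
    have "?y powr (- (s + 1)) = ?y powr (- s) * (1 / ?y)"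
      by (simp add: powr_diff)
    also have "\<dots> \<le> ?y powr (- s) * (1 / real m)"
      using that by (intro mult_left_mono divide_left_mono) auto
    finally show ?thesis using * by simp
  qed
  have "(\<Sum>m\<in>{k<..n}. real m powr (- (s + 1))) \<le> real k powr (- s) - real n powr (- s)" if "k \<le> n"
    using that
  proof (induction n rule: dec_induct)
    case (step m)
    have "{k<..Suc m} = insert (Suc m) {k<..m}" using step by auto
    then show ?case using step \<open>1 \<le> k\<close> \<open>\<And>m. 1 \<le> m \<Longrightarrow> _\<close>[of m] by simp
  qed simp
  then show ?thesis
    by (cases "k \<le> n") (auto intro: order_trans)
qed

lemma sum_far_le:
  fixes s :: real
  assumes "1 \<le> s" "1 \<le> k"
  shows "(\<Sum>j\<in>{1..d}. if real k < \<bar>real i - real j\<bar> then \<bar>real i - real j\<bar> powr (- (s + 1)) else 0)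
    \<le> 2 * real k powr (- s)" (is "sum ?f _ \<le> _")
proof -
  let ?g = "\<lambda>m. real m powr (- (s + 1))"
  let ?L = "{j \<in> {1..d}. j + k < i}" and ?U = "{j \<in> {1..d}. i + k < j}"
  have "sum ?f {1..d} = sum ?f (?L \<union> ?U)"
    by (intro sum.mono_neutral_right) auto
  also have "\<dots> = sum ?f ?L + sum ?f ?U"
    by (intro sum.union_disjoint) auto
  also have "sum ?f ?L = (\<Sum>m\<in>(\<lambda>j. i - j) ` ?L. ?g m)"
    by (subst sum.reindex) (auto simp: inj_on_def of_nat_diff intro!: sum.cong)
  also have "\<dots> \<le> (\<Sum>m\<in>{k<..i}. ?g m)"
    by (intro sum_mono2) auto
  also have "\<dots> \<le> real k powr (- s)"
    by (rule sum_inverse_powr_tail_le[OF assms])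
  also have "sum ?f ?U = (\<Sum>m\<in>(\<lambda>j. j - i) ` ?U. ?g m)"
    by (subst sum.reindex) (auto simp: inj_on_def of_nat_diff intro!: sum.cong)
  also have "\<dots> \<le> (\<Sum>m\<in>{k<..d}. ?g m)"
    by (intro sum_mono2) auto
  also have "\<dots> \<le> real k powr (- s)"
    by (rule sum_inverse_powr_tail_le[OF assms])
  finally show ?thesis by simp
qed

lemma card_near_le:
  "card {j \<in> {1..d}. \<bar>real i - real j\<bar> < 2 * real k} \<le> min d (4 * k)"
proof -
  have "{j \<in> {1..d}. \<bar>real i - real j\<bar> < 2 * real k} \<subseteq> {1..d}" by auto
  from card_mono[OF _ this] have "card {j \<in> {1..d}. \<bar>real i - real j\<bar> < 2 * real k} \<le> d" by simp
  moreover have "{j \<in> {1..d}. \<bar>real i - real j\<bar> < 2 * real k} \<subseteq> {i + 1 - 2 * k..<i + 2 * k}"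
    by auto
  from card_mono[OF _ this]
  have "card {j \<in> {1..d}. \<bar>real i - real j\<bar> < 2 * real k} \<le> 4 * k" by simp
  ultimately show ?thesis by simp
qed

text \<open>
  This turns the exponentially small clipping bias into one that is smaller than the required
  power of \<open>k\<close>, at the price of a constant depending on the power.
\<close>

lemma powr_le_exp:
  fixes x s :: real
  assumes "0 < x" "0 < s"
  shows "x powr s \<le> s powr s * exp x"
proof -
  have "ln (x / s) \<le> x / s - 1" using assms by (intro ln_le_minus_one) simp
  then have "s * ln (x / s) \<le> s * (x / s)" using assms by (intro mult_left_mono) auto
  then have "s * ln x \<le> s * ln s + x"
    using assms by (simp add: ln_div algebra_simps)
  then have "exp (s * ln x) \<le> exp (s * ln s + x)" by simp
  then show ?thesis using assms by (simp add: powr_def exp_add)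
qed

text \<open>
  The noise variance is proportional to the number \<open>N\<close> of blocks, and the noise hits at most
  \<open>min d (4 * k)\<close> entries in each row. With one block the row length \<open>d\<close> is the better bound, with
  several blocks \<open>N * k < 2 * d\<close> helps; the factor \<open>4 * k\<close> alone would fail when \<open>k\<close> exceeds \<open>d\<close>.
\<close>

lemma near_count_times_blocks_le:
  fixes d k N :: nat
  assumes "1 \<le> d" "N = 1 \<or> N * k < 2 * d"
  shows "real (min d (4 * k)) * real N \<le> 8 * real d"
proof -
  have "min d (4 * k) * N \<le> 8 * d"
  proof (cases "N = 1")
    case False
    then have "N * k < 2 * d" using assms by simp
    moreover have "min d (4 * k) * N \<le> 4 * k * N" by (intro mult_le_mono1) simp
    moreover have "4 * k * N = 4 * (N * k)" by simp
    ultimately show ?thesis by linarith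
  qed simp
  then show ?thesis by (simp flip: of_nat_mult of_nat_le_iff)
qed

lemma frob_norm_square: "(frob_norm d A)\<^sup>2 = (\<Sum>i\<in>{1..d}. \<Sum>j\<in>{1..d}. (A i j)\<^sup>2)"
  by (simp add: frob_norm_def L2_set_def sum_nonneg sum.cartesian_product case_prod_beta)

lemma tri_risk_eq_sum:
  assumes "\<And>i j. i \<in> {1..d} \<Longrightarrow> j \<in> {1..d} \<Longrightarrow>
      tri_error n d k \<rho> R S i j \<in> borel_measurable (sample_space n d k P)"
  shows "tri_risk n d k \<rho> R P S = (\<Sum>i\<in>{1..d}. \<Sum>j\<in>{1..d}.
      (\<integral>\<^sup>+z. ennreal ((tri_error n d k \<rho> R S i j z)\<^sup>2) \<partial>sample_space n d k P))"
proof -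
  have "tri_risk n d k \<rho> R P S = (\<integral>\<^sup>+z. (\<Sum>i\<in>{1..d}. \<Sum>j\<in>{1..d}.
      ennreal ((tri_error n d k \<rho> R S i j z)\<^sup>2)) \<partial>sample_space n d k P)"
    unfolding tri_risk_def
    by (intro nn_integral_cong) (auto simp: frob_norm_square tri_error_def case_prod_beta sum_nonneg simp flip: sum_ennreal)
  also have "\<dots> = (\<Sum>i\<in>{1..d}. (\<integral>\<^sup>+z. (\<Sum>j\<in>{1..d}.
      ennreal ((tri_error n d k \<rho> R S i j z)\<^sup>2)) \<partial>sample_space n d k P))"
    using assms by (intro nn_integral_sum borel_measurable_sum) measurable
  also have "\<dots> = (\<Sum>i\<in>{1..d}. \<Sum>j\<in>{1..d}.
      (\<integral>\<^sup>+z. ennreal ((tri_error n d k \<rho> R S i j z)\<^sup>2) \<partial>sample_space n d k P))"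
    using assms by (intro sum.cong refl nn_integral_sum) measurable
  finally show ?thesis .
qed

text \<open>
  Each row has few entries inside the blocks, all with the same risk bound \<open>V\<close>, and outside the blocks
  the decay \<open>\<bar>S i j\<bar>\<^sup>2 \<le> M\<^sup>2 * \<bar>i - j\<bar> powr (- (2 * \<alpha> + 2))\<close> is summed over distances beyond \<open>k\<close>.
  Distances between \<open>k\<close> and \<open>2 * k\<close> may occur in both roles and are charged to both sums.
\<close>

lemma tri_risk_le:
  assumes law: "data_law d K S P" and cls: "S \<in> cov_class d \<alpha> M0 M"
    and K: "0 < K" and \<alpha>: "0 < \<alpha>" and k: "1 \<le> k" and n: "1 \<le> n" and \<rho>: "0 < \<rho>"
    and R: "0 \<le> R" "16 * K\<^sup>2 * real k \<le> R\<^sup>2"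
    and N: "padded_dim d k = N * k" "d \<le> N * k" "1 \<le> N"
  shows "tri_risk n d k \<rho> R P S \<le> ennreal (real d *
    (real (min d (4 * k)) * (3 * (64 * K ^ 4 / real n + 36 * R ^ 4 * real N / (\<rho> * (real n)\<^sup>2)
        + 256 * K ^ 4 * exp (- real k)))
     + 2 * M\<^sup>2 * real k powr (- (2 * \<alpha> + 1))))"
proof -
  \<comment> \<open>The factor 2 is an arbitrary slack above \<open>K\<close>; the numerical constants follow from it.\<close>
  interpret subgaussian_law P d "2 * K"
    using data_law_subgaussian[OF law K, of "2 * K"] K by simp
  define V where "V = 3 * (64 * K ^ 4 / real n + 36 * R ^ 4 * real N / (\<rho> * (real n)\<^sup>2)
        + 256 * K ^ 4 * exp (- real k))"
  have V: "0 \<le> V" using R \<rho> by (simp add: V_def)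
  define u where "u i j = (if \<bar>real i - real j\<bar> < 2 * real k then V else 0)
    + M\<^sup>2 * (if real k < \<bar>real i - real j\<bar> then \<bar>real i - real j\<bar> powr (- (2 * \<alpha> + 1 + 1)) else 0)"
    for i j :: nat
  have u: "0 \<le> u i j" for i j using V by (simp add: u_def)
  let ?e = "tri_error n d k \<rho> R S"
  let ?\<Omega> = "sample_space n d k P"
  have S_sym: "S i j = S j i" if "i \<in> {1..d}" "j \<in> {1..d}" for i j
    using cls that by (auto simp: cov_class_def)
  have e_sym: "?e i j = ?e j i" if "i \<in> {1..d}" "j \<in> {1..d}" for i j
    using S_sym[OF that] by (auto simp: tri_error_def dp_cov_tri_commute[of _ _ _ _ _ _ _ i j])
  have R': "4 * (2 * K)\<^sup>2 * real k \<le> R\<^sup>2" using R by (simp add: power_mult_distrib)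
  have upper: "?e i j \<in> borel_measurable ?\<Omega> \<and> (\<integral>\<^sup>+z. ennreal ((?e i j z)\<^sup>2) \<partial>?\<Omega>) \<le> ennreal (u i j)"
    if ij: "1 \<le> i" "i \<le> j" "j \<le> d" for i j
  proof -
    have mem: "i \<in> {1..d}" "j \<in> {1..d}" using ij by auto
    note E = tri_error_upper[where i = i and j = j and S = S and N = N, OF k n \<rho> R(1) R' ij data_law_covariance[OF law mem] N]
    have "(\<integral>\<^sup>+z. ennreal ((?e i j z)\<^sup>2) \<partial>?\<Omega>) \<le> ennreal (u i j)"
    proof (cases "block_index k j \<le> block_index k i + 1")
      case True
      then have "j < i + 2 * k" using block_index_near_imp k ij by blast
      then have "V \<le> u i j" using ij by (simp add: u_def)
      then show ?thesis
        using E(2)[OF True] by (auto simp: V_def power_mult_distrib intro: order_trans ennreal_leI)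
    next
      case False
      then have far: "i + k < j" using block_index_far_imp[of k i j] k ij by simp
      then have "\<bar>S i j\<bar> \<le> M * \<bar>real i - real j\<bar> powr (- (\<alpha> + 1))"
        using cls mem unfolding cov_class_def by fastforce
      then have "(S i j)\<^sup>2 \<le> (M * \<bar>real i - real j\<bar> powr (- (\<alpha> + 1)))\<^sup>2"
        by (rule abs_le_square_iff[THEN iffD1, OF order_trans]) simp
      also have "\<dots> = M\<^sup>2 * \<bar>real i - real j\<bar> powr (- (2 * \<alpha> + 1 + 1))"
        by (simp add: power_mult_distrib power2_eq_square[of "_ powr _"] add.commute flip: powr_add)
      also have "\<dots> \<le> u i j"
        using far V by (simp add: u_def)
      finally show ?thesis
        using E(3) False by (simp add: ennreal_leI)
    qed
    with E(1) show ?thesis by simp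
  qed
  have u_sym: "u i j = u j i" for i j
    by (simp add: u_def abs_minus_commute)
  have entry: "?e i j \<in> borel_measurable ?\<Omega> \<and> (\<integral>\<^sup>+z. ennreal ((?e i j z)\<^sup>2) \<partial>?\<Omega>) \<le> ennreal (u i j)"
    if "i \<in> {1..d}" "j \<in> {1..d}" for i j
    using upper[of i j] upper[of j i] that e_sym[OF that] u_sym[of i j] by (cases "i \<le> j") auto
  have row: "(\<Sum>j\<in>{1..d}. u i j) \<le> real (min d (4 * k)) * V + 2 * M\<^sup>2 * real k powr (- (2 * \<alpha> + 1))"
    for i
  proof -
    have "(\<Sum>j\<in>{1..d}. if \<bar>real i - real j\<bar> < 2 * real k then V else 0)
        = real (card {j \<in> {1..d}. \<bar>real i - real j\<bar> < 2 * real k}) * V"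
      by (simp add: sum.If_cases Int_def)
    also have "\<dots> \<le> real (min d (4 * k)) * V"
      using card_near_le V by (intro mult_right_mono) (simp_all only: of_nat_le_iff)
    finally have "(\<Sum>j\<in>{1..d}. if \<bar>real i - real j\<bar> < 2 * real k then V else 0) \<le> real (min d (4 * k)) * V" .
    moreover have "M\<^sup>2 * (\<Sum>j\<in>{1..d}. if real k < \<bar>real i - real j\<bar>
        then \<bar>real i - real j\<bar> powr (- (2 * \<alpha> + 1 + 1)) else 0) \<le> M\<^sup>2 * (2 * real k powr (- (2 * \<alpha> + 1)))"
      using \<alpha> k by (intro mult_left_mono sum_far_le) auto
    ultimately show ?thesis
      unfolding u_def sum.distrib sum_distrib_left[symmetric] by linarith
  qed
  have "tri_risk n d k \<rho> R P S = (\<Sum>i\<in>{1..d}. \<Sum>j\<in>{1..d}. (\<integral>\<^sup>+z. ennreal ((?e i j z)\<^sup>2) \<partial>?\<Omega>))"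
    using entry by (intro tri_risk_eq_sum) blast
  also have "\<dots> \<le> (\<Sum>i\<in>{1..d}. \<Sum>j\<in>{1..d}. ennreal (u i j))"
    using entry by (intro sum_mono) blast
  also have "\<dots> = ennreal (\<Sum>i\<in>{1..d}. \<Sum>j\<in>{1..d}. u i j)"
    using u by (simp add: sum_nonneg)
  also have "(\<Sum>i\<in>{1..d}. \<Sum>j\<in>{1..d}. u i j)
      \<le> real d * (real (min d (4 * k)) * V + 2 * M\<^sup>2 * real k powr (- (2 * \<alpha> + 1)))"
    using sum_bounded_above[of "{1..d}" "\<lambda>i. \<Sum>j\<in>{1..d}. u i j", OF row] by simp
  finally show ?thesis
    unfolding V_def by (simp add: ennreal_leI)
qed

theorem theorem3p5:
  shows "\<exists>C0>0. \<exists>c>0. \<forall>C\<ge>C0. \<forall>\<alpha>>0. \<forall>K>0. \<forall>M0>0. \<forall>M>0. \<forall>a>0. \<forall>b>0. \<exists>C'>0.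
    \<forall>(n :: nat \<Rightarrow> nat) (d :: nat \<Rightarrow> nat) (\<rho> :: nat \<Rightarrow> real). regime a b n d \<rho> \<longrightarrow>
      (\<forall>\<^sub>F m in sequentially.
        \<forall>(k :: nat) (\<Sigma> :: rmat) (P :: rvec measure).
          1 \<le> k \<and> real k \<le> c * real (n m) \<and>
          \<Sigma> \<in> cov_class (d m) \<alpha> M0 M \<and> data_law (d m) K \<Sigma> P \<longrightarrow>
          ennreal (1 / real (d m)) *
            tri_risk (n m) (d m) k (\<rho> m) (C * K * sqrt (real k)) P \<Sigma>
          \<le> ennreal (C' * (real k / real (n m)
              + real (d m) * (real k)\<^sup>2 / (\<rho> m * (real (n m))\<^sup>2)
              + real k powr (- (2 * \<alpha> + 1)))))"
proof -
  define C' where "C' C \<alpha> K M = 768 * K ^ 4 + 864 * C ^ 4 * K ^ 4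
      + 3072 * K ^ 4 * (2 * \<alpha> + 2) powr (2 * \<alpha> + 2) + 2 * M\<^sup>2" for C \<alpha> K M :: real
  have bound: "ennreal (1 / real d) * tri_risk n d k \<rho> (C * K * sqrt (real k)) P \<Sigma>
      \<le> ennreal (C' C \<alpha> K M * (real k / real n + real d * (real k)\<^sup>2 / (\<rho> * (real n)\<^sup>2)
          + real k powr (- (2 * \<alpha> + 1))))"
    if C: "4 \<le> C" and \<alpha>: "0 < \<alpha>" and K: "0 < K" and n: "1 \<le> n" and \<rho>: "0 < \<rho>" and k: "1 \<le> k"
      and \<Sigma>: "\<Sigma> \<in> cov_class d \<alpha> M0 M" and P: "data_law d K \<Sigma> P"
    for C \<alpha> K M0 M \<rho> :: real and n d k :: nat and \<Sigma> :: rmat and P :: "rvec measure"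
  proof (cases "d = 0")
    case False
    define R where "R = C * K * sqrt (real k)"
    have R4: "R ^ 4 = C ^ 4 * K ^ 4 * (real k)\<^sup>2"
      by (simp add: R_def power_mult_distrib real_sqrt_power_even)
    have R: "0 \<le> R" "16 * K\<^sup>2 * real k \<le> R\<^sup>2"
      using C K power_mono[of 4 C 2] by (auto simp: R_def power_mult_distrib intro!: mult_right_mono)
    obtain N where N: "padded_dim d k = N * k" "d \<le> N * k" "1 \<le> N" "N = 1 \<or> N * k < 2 * d"
      using padded_dim_cases[OF k] by metis
    define q where "q = real (min d (4 * k))"
    define D where "D = real d * (real k)\<^sup>2 / (\<rho> * (real n)\<^sup>2)"
    define W where "W = real k powr (- (2 * \<alpha> + 1))"
    have q: "0 \<le> q" "q \<le> 4 * real k" by (auto simp: q_def)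
    have variance: "q * (3 * (64 * K ^ 4 / real n)) \<le> 768 * K ^ 4 * (real k / real n)"
      using mult_right_mono[OF q(2), of "192 * K ^ 4 / real n"] by (simp add: mult_ac)
    have privacy: "q * (3 * (36 * R ^ 4 * real N / (\<rho> * (real n)\<^sup>2))) \<le> 864 * C ^ 4 * K ^ 4 * D"
    proof -
      have "q * (3 * (36 * R ^ 4 * real N / (\<rho> * (real n)\<^sup>2)))
          = (q * real N) * (108 * C ^ 4 * K ^ 4 * (real k)\<^sup>2 / (\<rho> * (real n)\<^sup>2))"
        by (simp add: R4)
      also have "\<dots> \<le> (8 * real d) * (108 * C ^ 4 * K ^ 4 * (real k)\<^sup>2 / (\<rho> * (real n)\<^sup>2))"
        using near_count_times_blocks_le[of d N k] False N \<rho>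
        by (intro mult_right_mono) (auto simp: q_def)
      also have "\<dots> = 864 * C ^ 4 * K ^ 4 * D" by (simp add: D_def)
      finally show ?thesis .
    qed
    \<comment> \<open>The power \<open>2 * \<alpha> + 2\<close> is the target \<open>2 * \<alpha> + 1\<close> plus one for the number of block entries in a row.\<close>
    have clip: "q * (3 * (256 * K ^ 4 * exp (- real k)))
        \<le> 3072 * K ^ 4 * (2 * \<alpha> + 2) powr (2 * \<alpha> + 2) * W"
    proof -
      have "real k powr (2 * \<alpha> + 2) \<le> (2 * \<alpha> + 2) powr (2 * \<alpha> + 2) * exp (real k)"
        using k \<alpha> by (intro powr_le_exp) auto
      then have "real k powr (2 * \<alpha> + 2) * (W * exp (- real k))
          \<le> (2 * \<alpha> + 2) powr (2 * \<alpha> + 2) * exp (real k) * (W * exp (- real k))"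
        by (intro mult_right_mono) (auto simp: W_def)
      moreover have "real k powr (2 * \<alpha> + 2) * W = real k"
        using k by (simp add: W_def flip: powr_add)
      ultimately have k_exp: "real k * exp (- real k) \<le> (2 * \<alpha> + 2) powr (2 * \<alpha> + 2) * W"
        by (simp add: exp_minus mult.assoc[symmetric]) (simp add: field_simps)
      have "q * (3 * (256 * K ^ 4 * exp (- real k))) \<le> 3072 * K ^ 4 * (real k * exp (- real k))"
        using mult_right_mono[OF q(2), of "768 * K ^ 4 * exp (- real k)"] by simp
      also have "\<dots> \<le> 3072 * K ^ 4 * ((2 * \<alpha> + 2) powr (2 * \<alpha> + 2) * W)"
        by (intro mult_left_mono k_exp) simp
      finally show ?thesis by (simp add: mult.assoc)
    qed
    have nonneg: "0 \<le> real k / real n" "0 \<le> D" "0 \<le> W"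
      using \<rho> by (auto simp: D_def W_def)
    have "ennreal (1 / real d) * tri_risk n d k \<rho> R P \<Sigma>
        \<le> ennreal (1 / real d) * ennreal (real d * (q * (3 * (64 * K ^ 4 / real n
            + 36 * R ^ 4 * real N / (\<rho> * (real n)\<^sup>2) + 256 * K ^ 4 * exp (- real k))) + 2 * M\<^sup>2 * W))"
      unfolding q_def W_def by (intro mult_left_mono tri_risk_le[OF P \<Sigma> K \<alpha> k n \<rho> R N(1-3)]) simp
    also have "\<dots> = ennreal (q * (3 * (64 * K ^ 4 / real n
            + 36 * R ^ 4 * real N / (\<rho> * (real n)\<^sup>2) + 256 * K ^ 4 * exp (- real k))) + 2 * M\<^sup>2 * W)"
      using False by (simp flip: ennreal_mult')
    also have "\<dots> \<le> ennreal (768 * K ^ 4 * (real k / real n) + 864 * C ^ 4 * K ^ 4 * D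
          + 3072 * K ^ 4 * (2 * \<alpha> + 2) powr (2 * \<alpha> + 2) * W + 2 * M\<^sup>2 * W)"
      using variance privacy clip by (intro ennreal_leI) (simp only: distrib_left)
    also have "\<dots> \<le> ennreal (C' C \<alpha> K M * (real k / real n + D + W))"
    proof (intro ennreal_leI)
      have expand: "x * p + y * q + z * r + w * r \<le> (x + y + z + w) * (p + q + r)"
        if "0 \<le> x" "0 \<le> y" "0 \<le> z" "0 \<le> w" "0 \<le> p" "0 \<le> q" "0 \<le> r" for x y z w p q r :: real
        using that by (simp add: algebra_simps add_nonneg_nonneg)
      show "768 * K ^ 4 * (real k / real n) + 864 * C ^ 4 * K ^ 4 * D
          + 3072 * K ^ 4 * (2 * \<alpha> + 2) powr (2 * \<alpha> + 2) * W + 2 * M\<^sup>2 * W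
          \<le> C' C \<alpha> K M * (real k / real n + D + W)"
        unfolding C'_def by (rule expand) (use nonneg in auto)
    qed
    finally show ?thesis unfolding D_def W_def R_def .
  qed simp
  show ?thesis
  \<comment> \<open>For \<open>4 \<le> C\<close> the radius satisfies \<open>16 * K\<^sup>2 * k \<le> R\<^sup>2\<close>, the threshold of the norm bound at
    \<open>t = 2 * K\<close>.\<close>
  proof (rule exI[of _ 4], intro conjI, simp, rule exI[of _ 1], intro conjI allI impI, simp)
    fix C \<alpha> K M0 M a b :: real
    assume *: "4 \<le> C" "0 < \<alpha>" "0 < K" "0 < M"
    have C'pos: "0 < C' C \<alpha> K M"
      unfolding C'_def using * by (intro add_pos_nonneg) auto
    show "\<exists>C'>0. \<forall>n d \<rho>. regime a b n d \<rho> \<longrightarrow>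
      (\<forall>\<^sub>F m in sequentially.
        \<forall>k \<Sigma> P. 1 \<le> k \<and> real k \<le> 1 * real (n m) \<and>
          \<Sigma> \<in> cov_class (d m) \<alpha> M0 M \<and> data_law (d m) K \<Sigma> P \<longrightarrow>
          ennreal (1 / real (d m)) *
            tri_risk (n m) (d m) k (\<rho> m) (C * K * sqrt (real k)) P \<Sigma>
          \<le> ennreal (C' * (real k / real (n m)
              + real (d m) * (real k)\<^sup>2 / (\<rho> m * (real (n m))\<^sup>2)
              + real k powr (- (2 * \<alpha> + 1)))))"
    proof (intro exI[of _ "C' C \<alpha> K M"] conjI C'pos allI impI)
      fix n d :: "nat \<Rightarrow> nat" and \<rho> :: "nat \<Rightarrow> real"
      assume "regime a b n d \<rho>"
      then have "\<forall>\<^sub>F m in sequentially. 0 < \<rho> m \<and> \<rho> m \<le> b"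
        by (simp add: regime_def)
      then show "\<forall>\<^sub>F m in sequentially.
        \<forall>k \<Sigma> P. 1 \<le> k \<and> real k \<le> 1 * real (n m) \<and>
          \<Sigma> \<in> cov_class (d m) \<alpha> M0 M \<and> data_law (d m) K \<Sigma> P \<longrightarrow>
          ennreal (1 / real (d m)) *
            tri_risk (n m) (d m) k (\<rho> m) (C * K * sqrt (real k)) P \<Sigma>
          \<le> ennreal (C' C \<alpha> K M * (real k / real (n m)
              + real (d m) * (real k)\<^sup>2 / (\<rho> m * (real (n m))\<^sup>2)
              + real k powr (- (2 * \<alpha> + 1))))"
        by eventually_elim (intro allI impI bound; use * in auto)
    qed
  qed
qed

end
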